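(* Let $M\ge2$, $\boldsymbol{x}=(x_1,\dots,x_M)\in\mathbb{R}^M$ with $x_1<\cdots<x_M$, and $\boldsymbol{y}_0\in\mathbb{R}^M$. The following conditions are equivalent. 1. (gBPC) has a unique solution. 2. The canonical dual certificate $\eta_{\mathrm{cano}}$ is nondegenerate. 3. For all $m\in\{2,\dots,M-2\}$, $a_ma_{m+1}\le0$.
   Context: $\mathcal{M}(\mathbb{R})$ is the space of bounded (finite, signed) Radon measures on $\mathbb{R}$ with total-variation norm $\|\cdot\|_{\mathcal{M}}$. $\mathrm{BV}^{(2)}(\mathbb{R})=\{f\in\mathcal{S}'(\mathbb{R}):\mathrm{D}^2f\in\mathcal{M}(\mathbb{R})\}$, where $\mathrm{D}^2$ is the distributional second derivative; its elements are continuous functions. Write $(t)_+=\max(0,t)$. (gBPC) is the problem of minimizing $\|\mathrm{D}^2f\|_{\mathcal{M}}$ over all $f\in\mathrm{BV}^{(2)}(\mathbb{R})$ with $f(x_m)=y_{0,m}$ for $m=1,\dots,M$; a solution is a minimizer. $a_m=\frac{y_{0,m+1}-y_{0,m}}{x_{m+1}-x_m}-\frac{y_{0,m}-y_{0,m-1}}{x_m-x_{m-1}}$ for $2\le m\le M-1$. The canonical dual certificate $\eta_{\mathrm{cano}}$ is the unique function $\eta_{\mathrm{cano}}=\sum_{m=1}^Mc_m(x_m-\cdot)_+$, $\boldsymbol{c}\in\mathbb{R}^M$, with $\sum_mc_m=\sum_mc_mx_m=0$ and $\eta_{\mathrm{cano}}(x_m)=\mathrm{sign}(a_m)$ for $m=2,\dots,M-1$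 ($\mathrm{sign}(0)=0$). It is nondegenerate if its signed saturation set $\{x:\eta_{\mathrm{cano}}(x)=1\}\times\{1\}\cup\{x:\eta_{\mathrm{cano}}(x)=-1\}\times\{-1\}$ is a discrete set. *)

theory Defs
  imports "HOL-Analysis.Analysis"
begin

text \<open>
  A real-valued countably additive set function on the Borel sets is automatically bounded and,
  on the real line, automatically Radon. Its values on non-Borel sets are fixed to 0, so that
  equality of functions is equality of measures.
\<close>

definition signed_measures :: "(real set \<Rightarrow> real) set" where
  "signed_measures =
     {\<mu>. \<mu> {} = 0 \<and>
         (\<forall>A :: nat \<Rightarrow> real set. range A \<subseteq> sets borel \<longrightarrow> disjoint_family A \<longrightarrow>
            (\<lambda>i. \<mu> (A i)) sums \<mu> (\<Union>i. A i)) \<and>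
         (\<forall>A. A \<notin> sets borel \<longrightarrow> \<mu> A = 0)}"

definition total_variation :: "(real set \<Rightarrow> real) \<Rightarrow> ennreal" where
  "total_variation \<mu> =
     (SUP P \<in> {P. finite P \<and> P \<subseteq> sets borel \<and> disjoint P}. \<Sum>A\<in>P. ennreal \<bar>\<mu> A\<bar>)"

text \<open>
  Positive part of the Jordan decomposition; the truncation of negative reals by
  \<^const>\<open>ennreal\<close> is harmless, as the supremum includes the empty set.
\<close>

definition positive_part :: "(real set \<Rightarrow> real) \<Rightarrow> real measure" where
  "positive_part \<mu> =
     measure_of UNIV (sets borel) (\<lambda>A. SUP B \<in> {B \<in> sets borel. B \<subseteq> A}. ennreal (\<mu> B))"

definition signed_integral :: "(real set \<Rightarrow> real) \<Rightarrow> (real \<Rightarrow> real) \<Rightarrow> real" where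
  "signed_integral \<mu> \<phi> =
     (LINT t|positive_part \<mu>. \<phi> t) - (LINT t|positive_part (\<lambda>A. - \<mu> A). \<phi> t)"

definition schwartz_seminorm :: "nat \<Rightarrow> nat \<Rightarrow> (real \<Rightarrow> real) \<Rightarrow> real" where
  "schwartz_seminorm k n \<phi> = (SUP t. \<bar>t ^ k * (deriv ^^ n) \<phi> t\<bar>)"

definition schwartz_space :: "(real \<Rightarrow> real) set" where
  "schwartz_space =
     {\<phi>. (\<forall>n. (deriv ^^ n) \<phi> differentiable_on UNIV) \<and>
         (\<forall>k n. bounded (range (\<lambda>t. t ^ k * (deriv ^^ n) \<phi> t)))}"

text \<open>
  Distributions are extensional functionals on Schwartz space. The last conjunct is
  continuity with respect to the family of Schwartz seminorms.
\<close>

definition tempered_distributions :: "((real \<Rightarrow> real) \<Rightarrow> real) set" where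
  "tempered_distributions =
     {T \<in> extensional schwartz_space.
        (\<forall>\<phi>\<in>schwartz_space. \<forall>\<psi>\<in>schwartz_space. T (\<lambda>t. \<phi> t + \<psi> t) = T \<phi> + T \<psi>) \<and>
        (\<forall>a. \<forall>\<phi>\<in>schwartz_space. T (\<lambda>t. a * \<phi> t) = a * T \<phi>) \<and>
        (\<exists>C N. \<forall>\<phi>\<in>schwartz_space.
           \<bar>T \<phi>\<bar> \<le> C * (\<Sum>k\<le>N. \<Sum>n\<le>N. schwartz_seminorm k n \<phi>))}"

definition distr_D2 :: "((real \<Rightarrow> real) \<Rightarrow> real) \<Rightarrow> (real \<Rightarrow> real) \<Rightarrow> real" where
  "distr_D2 T = restrict (\<lambda>\<phi>. T (deriv (deriv \<phi>))) schwartz_space"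

definition measure_distr :: "(real set \<Rightarrow> real) \<Rightarrow> (real \<Rightarrow> real) \<Rightarrow> real" where
  "measure_distr \<mu> = restrict (signed_integral \<mu>) schwartz_space"

text \<open>
  Requiring absolute integrability of \<open>f * \<phi>\<close> loses nothing below: distributions whose second
  derivative is a finite measure are continuous functions of at most linear growth.
\<close>

definition is_continuous_function ::
  "((real \<Rightarrow> real) \<Rightarrow> real) \<Rightarrow> (real \<Rightarrow> real) \<Rightarrow> bool" where
  "is_continuous_function T f \<longleftrightarrow>
     continuous_on UNIV f \<and>
     (\<forall>\<phi>\<in>schwartz_space. integrable lborel (\<lambda>t. f t * \<phi> t) \<and> T \<phi> = (LINT t|lborel. f t * \<phi> t))"

definition bounded_measures :: "((real \<Rightarrow> real) \<Rightarrow> real) set" where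
  "bounded_measures = measure_distr ` signed_measures"

definition norm_M :: "((real \<Rightarrow> real) \<Rightarrow> real) \<Rightarrow> ennreal" where
  "norm_M w = total_variation (the_inv_into signed_measures measure_distr w)"

definition BV2 :: "((real \<Rightarrow> real) \<Rightarrow> real) set" where
  "BV2 = {T \<in> tempered_distributions. distr_D2 T \<in> bounded_measures}"

text \<open>
  Point values of an element of \<^const>\<open>BV2\<close> are those of its (unique) continuous representative.
  Only the indices \<open>1, \<dots>, M\<close> of the vectors \<open>x\<close> and \<open>y\<close> matter.
\<close>

definition gBPC_feasible ::
  "nat \<Rightarrow> (nat \<Rightarrow> real) \<Rightarrow> (nat \<Rightarrow> real) \<Rightarrow> ((real \<Rightarrow> real) \<Rightarrow> real) set" where
  "gBPC_feasible M x y =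
     {T \<in> BV2. \<exists>f. is_continuous_function T f \<and> (\<forall>m\<in>{1..M}. f (x m) = y m)}"

definition gBPC_solution ::
  "nat \<Rightarrow> (nat \<Rightarrow> real) \<Rightarrow> (nat \<Rightarrow> real) \<Rightarrow> ((real \<Rightarrow> real) \<Rightarrow> real) \<Rightarrow> bool" where
  "gBPC_solution M x y =
     is_arg_min (\<lambda>T. norm_M (distr_D2 T)) (\<lambda>T. T \<in> gBPC_feasible M x y)"

definition slope_change :: "(nat \<Rightarrow> real) \<Rightarrow> (nat \<Rightarrow> real) \<Rightarrow> nat \<Rightarrow> real" where
  "slope_change x y m =
     (y (m + 1) - y m) / (x (m + 1) - x m) - (y m - y (m - 1)) / (x m - x (m - 1))"

definition eta_cano :: "nat \<Rightarrow> (nat \<Rightarrow> real) \<Rightarrow> (nat \<Rightarrow> real) \<Rightarrow> real \<Rightarrow> real" where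
  "eta_cano M x y =
     (THE \<eta>. \<exists>c :: nat \<Rightarrow> real.
        \<eta> = (\<lambda>t. \<Sum>m\<in>{1..M}. c m * max 0 (x m - t)) \<and>
        (\<Sum>m\<in>{1..M}. c m) = 0 \<and> (\<Sum>m\<in>{1..M}. c m * x m) = 0 \<and>
        (\<forall>m\<in>{2..M-1}. \<eta> (x m) = sgn (slope_change x y m)))"

definition signed_saturation_set :: "(real \<Rightarrow> real) \<Rightarrow> (real \<times> real) set" where
  "signed_saturation_set \<eta> = {t. \<eta> t = 1} \<times> {1} \<union> {t. \<eta> t = -1} \<times> {-1}"

definition nondegenerate :: "(real \<Rightarrow> real) \<Rightarrow> bool" where
  "nondegenerate \<eta> \<longleftrightarrow> discrete (signed_saturation_set \<eta>)"

end

theory Submission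
  imports Defs
begin

text \<open>
  The proof is convex duality with a piecewise linear certificate. Let \<open>f\<close> be feasible with
  \<open>D\<^sup>2 f = \<mu>\<close>, and let \<open>\<eta> = (\<Sum>m. c m * max 0 (x m - t))\<close> with \<open>(\<Sum>m. c m) = (\<Sum>m. c m * x m) = 0\<close>.
  Such an \<open>\<eta>\<close> is continuous and piecewise linear, vanishes outside \<open>[x 1, x M]\<close>, and has second
  derivative \<open>\<Sum>m. c m * \<delta>(x m)\<close>. Moving two derivatives across therefore gives
  \<open>\<integral> \<eta> d\<mu> = (\<Sum>m. c m * f (x m)) = (\<Sum>m. c m * y m)\<close>, a number that depends on the data only
  (\<open>weak_second_deriv_hats\<close>). Evaluated at the piecewise linear interpolant, whose second
  derivative is \<open>\<Sum>m. a m * \<delta>(x m)\<close> with \<open>a m\<close> the slope changes, this number is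
  \<open>(\<Sum>m. a m * sgn (a m)) = (\<Sum>m. \<bar>a m\<bar>)\<close> for the canonical certificate. As \<open>\<bar>\<eta>\<bar> \<le> 1\<close>, every
  feasible \<open>\<mu>\<close> has total variation at least \<open>\<Sum>m. \<bar>a m\<bar>\<close>, and the interpolant attains it.
\<close>

text \<open>
  Between neighbouring knots \<open>\<eta>\<close> is a convex combination of two values in \<open>{-1, 0, 1}\<close>. Hence it
  saturates on a whole segment exactly if two neighbouring slope changes have the same nonzero
  sign; otherwise it saturates at most at interior knots (\<open>nondegenerate_iff\<close>).
  In the latter case an optimal \<open>\<mu>\<close> is carried by the interior knots, because equality holds in
  the duality bound only for measures carried by the saturation set (\<open>extremal_measure_null\<close>).
  Pairing \<open>\<mu>\<close> with the hat function of each interior knot recovers its mass there from the data,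
  so \<open>\<mu>\<close> is the second derivative of the interpolant, and \<open>f\<close> is the interpolant
  (\<open>unique_solution\<close>). In the former case the two kinks of equal sign can be merged into a single
  kink at their barycentre without changing the data or the cost, which gives a second solution
  (\<open>second_solution\<close>).
\<close>

text \<open>
  The test functions that make this rigorous all come from the softplus function
  \<open>ln (1 + exp u)\<close>. Rescaled softplus functions converge uniformly to \<open>max 0 u\<close>; their balanced
  combinations decay exponentially with all derivatives, hence are Schwartz functions, and their
  second derivatives combine bumps that form an approximate identity. The same functions separate
  signed measures, so that a measure is determined by the distribution it induces
  (\<open>signed_measure_eqI\<close>).
\<close>

section \<open>Signed measures and their Jordan decomposition\<close>

lemma signed_measuresD:
  assumes "\<mu> \<in> signed_measures"
  shows "\<mu> {} = 0"
    and "\<And>A :: nat \<Rightarrow> real set. range A \<subseteq> sets borel \<Longrightarrow> disjoint_family A \<Longrightarrow>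
           (\<lambda>i. \<mu> (A i)) sums \<mu> (\<Union>i. A i)"
    and "\<And>A. A \<notin> sets borel \<Longrightarrow> \<mu> A = 0"
  using assms unfolding signed_measures_def by auto

lemma signed_measure_Un:
  assumes \<mu>: "\<mu> \<in> signed_measures"
    and "A \<in> sets borel" "B \<in> sets borel" "A \<inter> B = {}"
  shows "\<mu> (A \<union> B) = \<mu> A + \<mu> B"
proof -
  have "range (binaryset A B) \<subseteq> sets borel"
    using assms by (auto simp: range_binaryset_eq)
  moreover have "disjoint_family (binaryset A B)"
    using assms by (auto simp: disjoint_family_on_def binaryset_def)
  ultimately have "(\<lambda>i. \<mu> (binaryset A B i)) sums \<mu> (A \<union> B)"
    using signed_measuresD(2)[OF \<mu>] by (metis UN_binaryset_eq)
  moreover have "(\<lambda>i. \<mu> (binaryset A B i)) sums (\<mu> A + \<mu> B)"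
    using signed_measuresD(1)[OF \<mu>] by (rule binaryset_sums)
  ultimately show ?thesis by (rule sums_unique2)
qed

lemma signed_measure_Diff:
  assumes "\<mu> \<in> signed_measures" "A \<in> sets borel" "B \<in> sets borel" "B \<subseteq> A"
  shows "\<mu> (A - B) = \<mu> A - \<mu> B"
  using signed_measure_Un[of \<mu> B "A - B"] assms by (simp add: Un_absorb1)

lemma signed_measures_uminus:
  assumes "\<mu> \<in> signed_measures"
  shows "(\<lambda>A. - \<mu> A) \<in> signed_measures"
  using assms unfolding signed_measures_def by (auto intro: sums_minus)

text \<open>
  Otherwise one could split off, again and again, a piece of mass at least one from a set on
  which the measure is still unbounded; the pieces are disjoint, so their masses must tend to
  zero.
\<close>

lemma signed_measure_bounded:
  assumes \<mu>: "\<mu> \<in> signed_measures"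
  shows "\<exists>C. \<forall>B\<in>sets borel. \<bar>\<mu> B\<bar> \<le> C"
proof (rule ccontr)
  define unb where "unb A \<longleftrightarrow> A \<in> sets borel \<and> (\<forall>C. \<exists>B\<in>sets borel. B \<subseteq> A \<and> \<bar>\<mu> B\<bar> > C)" for A
  assume "\<not> (\<exists>C. \<forall>B\<in>sets borel. \<bar>\<mu> B\<bar> \<le> C)"
  then have start: "unb UNIV" unfolding unb_def by (auto simp: not_le)
  have step: "\<exists>A'. unb A' \<and> A' \<subseteq> A \<and> \<bar>\<mu> (A - A')\<bar> \<ge> 1" if "unb A" for A
  proof -
    have A: "A \<in> sets borel" using that unfolding unb_def by auto
    have "\<exists>B\<in>sets borel. B \<subseteq> A \<and> \<bar>\<mu> B\<bar> > \<bar>\<mu> A\<bar> + 1"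
      using \<open>unb A\<close> unfolding unb_def by simp
    then obtain B where B: "B \<in> sets borel" "B \<subseteq> A" "\<bar>\<mu> B\<bar> > \<bar>\<mu> A\<bar> + 1"
      by auto
    have D: "\<mu> (A - B) = \<mu> A - \<mu> B" using signed_measure_Diff[OF \<mu> A] B by simp
    have "unb B \<or> unb (A - B)"
    proof (rule ccontr)
      assume "\<not> (unb B \<or> unb (A - B))"
      then obtain C1 C2 where C: "\<And>E. E \<in> sets borel \<Longrightarrow> E \<subseteq> B \<Longrightarrow> \<bar>\<mu> E\<bar> \<le> C1"
          "\<And>E. E \<in> sets borel \<Longrightarrow> E \<subseteq> A - B \<Longrightarrow> \<bar>\<mu> E\<bar> \<le> C2"
        using A B unfolding unb_def by (metis not_le sets.Diff)
      have "\<bar>\<mu> E\<bar> \<le> C1 + C2" if E: "E \<in> sets borel" "E \<subseteq> A" for E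
      proof -
        have "\<mu> E = \<mu> (E \<inter> B) + \<mu> (E - B)"
          using signed_measure_Un[OF \<mu>, of "E \<inter> B" "E - B"] E B by (simp add: Int_Diff_Un Int_Diff_disjoint)
        moreover have "\<bar>\<mu> (E \<inter> B)\<bar> \<le> C1" "\<bar>\<mu> (E - B)\<bar> \<le> C2"
          using E B by (auto intro!: C)
        ultimately show ?thesis by linarith
      qed
      then show False using \<open>unb A\<close> unfolding unb_def by (metis not_le)
    qed
    then show ?thesis
    proof
      assume "unb B"
      moreover have "\<bar>\<mu> (A - B)\<bar> \<ge> 1" using B(3) D by linarith
      ultimately show ?thesis using B(2) by blast
    next
      assume "unb (A - B)"
      moreover have "A - (A - B) = B" using B by auto
      moreover have "\<bar>\<mu> B\<bar> \<ge> 1" using B(3) by linarith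
      ultimately show ?thesis by (metis Diff_subset)
    qed
  qed
  obtain A where A: "\<And>n. unb (A n)" "\<And>n. A (Suc n) \<subseteq> A n \<and> \<bar>\<mu> (A n - A (Suc n))\<bar> \<ge> 1"
    using dependent_nat_choice[of "\<lambda>_. unb" "\<lambda>_ S S'. S' \<subseteq> S \<and> \<bar>\<mu> (S - S')\<bar> \<ge> 1"] start step by metis
  have dec: "A n \<subseteq> A m" if "m \<le> n" for m n
    using A(2) lift_Suc_antimono_le[of A, OF _ that] by blast
  have "disjoint_family (\<lambda>n. A n - A (Suc n))"
    unfolding disjoint_family_on_def
  proof (intro ballI impI)
    fix m n :: nat
    assume "m \<noteq> n"
    then have "A n \<subseteq> A (Suc m) \<or> A m \<subseteq> A (Suc n)"
      using dec[of "Suc m" n] dec[of "Suc n" m] by (meson Suc_leI linorder_neqE_nat)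
    then show "(A m - A (Suc m)) \<inter> (A n - A (Suc n)) = {}" by blast
  qed
  moreover have "range (\<lambda>n. A n - A (Suc n)) \<subseteq> sets borel"
    using A(1) unfolding unb_def by auto
  ultimately have "summable (\<lambda>n. \<mu> (A n - A (Suc n)))"
    using signed_measuresD(2)[OF \<mu>] by (blast intro: sums_summable)
  then have "(\<lambda>n. \<mu> (A n - A (Suc n))) \<longlonglongrightarrow> 0" by (rule summable_LIMSEQ_zero)
  then have "\<forall>\<^sub>F n in sequentially. \<bar>\<mu> (A n - A (Suc n))\<bar> < 1"
    using order_tendstoD(2)[OF tendsto_rabs_zero, of _ _ 1] by auto
  then show False using A(2) by (auto simp: eventually_sequentially not_less dest: leD)
qed

definition upper_variation :: "(real set \<Rightarrow> real) \<Rightarrow> real set \<Rightarrow> ennreal" where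
  "upper_variation \<mu> A = (SUP B \<in> {B \<in> sets borel. B \<subseteq> A}. ennreal (\<mu> B))"

lemma upper_variation_upper:
  "B \<in> sets borel \<Longrightarrow> B \<subseteq> A \<Longrightarrow> ennreal (\<mu> B) \<le> upper_variation \<mu> A"
  unfolding upper_variation_def by (intro SUP_upper) auto

text \<open>
  Near-optimal subsets of \<open>A\<close> and \<open>A'\<close> may be united; a subset of negative mass, which
  \<^const>\<open>ennreal\<close> counts as zero, has to be left out of the union.
\<close>

lemma upper_variation_superadd:
  assumes \<mu>: "\<mu> \<in> signed_measures" and "A \<inter> A' = {}"
  shows "upper_variation \<mu> A + upper_variation \<mu> A' \<le> upper_variation \<mu> (A \<union> A')"
proof -
  have "ennreal (\<mu> B) + ennreal (\<mu> B') \<le> upper_variation \<mu> (A \<union> A')"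
    if B: "B \<in> sets borel" "B \<subseteq> A" and B': "B' \<in> sets borel" "B' \<subseteq> A'" for B B'
  proof -
    have *: "\<mu> (B \<union> B') = \<mu> B + \<mu> B'"
      using B B' assms(2) by (intro signed_measure_Un[OF \<mu>]) auto
    have "ennreal (\<mu> B) + ennreal (\<mu> B') \<le> max (ennreal (\<mu> (B \<union> B'))) (max (ennreal (\<mu> B)) (ennreal (\<mu> B')))"
      unfolding * by (cases "\<mu> B \<ge> 0"; cases "\<mu> B' \<ge> 0")
        (auto simp: ennreal_neg max_def simp flip: ennreal_plus)
    also have "\<dots> \<le> upper_variation \<mu> (A \<union> A')"
      using B B' by (auto intro!: upper_variation_upper)
    finally show ?thesis .
  qed
  then have "(SUP B' \<in> {B' \<in> sets borel. B' \<subseteq> A'}. (SUP B \<in> {B \<in> sets borel. B \<subseteq> A}. ennreal (\<mu> B) + ennreal (\<mu> B')))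
      \<le> upper_variation \<mu> (A \<union> A')"
    by (intro SUP_least) auto
  moreover have ne: "{B \<in> sets borel. B \<subseteq> X} \<noteq> {}" for X :: "real set" by auto
  ultimately show ?thesis
    unfolding upper_variation_def by (simp add: ennreal_SUP_add_left ennreal_SUP_add_right ne)
qed

lemma ennreal_sum_le: "ennreal (\<Sum>i\<in>I. a i) \<le> (\<Sum>i\<in>I. ennreal (a i))"
proof (induction I rule: infinite_finite_induct)
  case (insert i I)
  have "ennreal (u + v) \<le> ennreal u + ennreal v" for u v
    by (cases "u \<ge> 0"; cases "v \<ge> 0")
      (auto simp: ennreal_neg intro!: ennreal_leI simp flip: ennreal_plus)
  with insert show ?case by simp (meson add_left_mono order_trans)
qed auto

lemma ennreal_sums_le:
  assumes "a sums s"
  shows "ennreal s \<le> (\<Sum>i. ennreal (a i))"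
proof (rule LIMSEQ_le_const2)
  show "(\<lambda>n. ennreal (\<Sum>i<n. a i)) \<longlonglongrightarrow> ennreal s"
    using assms unfolding sums_def by (intro tendsto_ennrealI)
  show "\<exists>N. \<forall>n\<ge>N. ennreal (\<Sum>i<n. a i) \<le> (\<Sum>i. ennreal (a i))"
    by (auto intro!: exI[of _ 0] order_trans[OF ennreal_sum_le] sum_le_suminf)
qed

lemma upper_variation_countably_additive:
  assumes \<mu>: "\<mu> \<in> signed_measures"
  shows "countably_additive (sets borel) (upper_variation \<mu>)"
proof (rule countably_additiveI)
  fix A :: "nat \<Rightarrow> real set"
  assume A: "range A \<subseteq> sets borel" "disjoint_family A"
  have fin: "(\<Sum>i<n. upper_variation \<mu> (A i)) \<le> upper_variation \<mu> (\<Union>i<n. A i)" for n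
  proof (induction n)
    case (Suc n)
    have "A i \<inter> A n = {}" if "i < n" for i using disjoint_family_onD[OF A(2), of i n] that by simp
    then have "(\<Union>i<n. A i) \<inter> A n = {}" by blast
    then have "upper_variation \<mu> (\<Union>i<n. A i) + upper_variation \<mu> (A n) \<le> upper_variation \<mu> ((\<Union>i<n. A i) \<union> A n)"
      by (rule upper_variation_superadd[OF \<mu>])
    moreover have "(\<Union>i<Suc n. A i) = (\<Union>i<n. A i) \<union> A n" by (auto simp: less_Suc_eq)
    moreover have "(\<Sum>i<Suc n. upper_variation \<mu> (A i)) \<le> upper_variation \<mu> (\<Union>i<n. A i) + upper_variation \<mu> (A n)"
      using Suc by (simp add: add_right_mono)
    ultimately show ?case by (metis order_trans)
  qed simp
  show "(\<Sum>i. upper_variation \<mu> (A i)) = upper_variation \<mu> (\<Union>i. A i)"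
  proof (rule antisym)
    have "upper_variation \<mu> (\<Union>i<n. A i) \<le> upper_variation \<mu> (\<Union>i. A i)" for n
      unfolding upper_variation_def by (intro SUP_subset_mono) auto
    then show "(\<Sum>i. upper_variation \<mu> (A i)) \<le> upper_variation \<mu> (\<Union>i. A i)"
      unfolding suminf_eq_SUP using fin by (intro SUP_least) (meson order_trans)
    show "upper_variation \<mu> (\<Union>i. A i) \<le> (\<Sum>i. upper_variation \<mu> (A i))"
      unfolding upper_variation_def[of _ "\<Union>i. A i"]
    proof (rule SUP_least)
      fix B assume "B \<in> {B \<in> sets borel. B \<subseteq> (\<Union>i. A i)}"
      then have B: "B \<in> sets borel" "(\<Union>i. B \<inter> A i) = B" by auto
      have "(\<lambda>i. \<mu> (B \<inter> A i)) sums \<mu> (\<Union>i. B \<inter> A i)"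
        using A B by (intro signed_measuresD(2)[OF \<mu>]) (auto simp: disjoint_family_on_def)
      then have "ennreal (\<mu> B) \<le> (\<Sum>i. ennreal (\<mu> (B \<inter> A i)))"
        using ennreal_sums_le B(2) by auto
      also have "\<dots> \<le> (\<Sum>i. upper_variation \<mu> (A i))"
        using A B by (intro suminf_le upper_variation_upper) auto
      finally show "ennreal (\<mu> B) \<le> (\<Sum>i. upper_variation \<mu> (A i))" .
    qed
  qed
qed

lemma sets_positive_part [measurable_cong, simp]: "sets (positive_part \<mu>) = sets borel"
  unfolding positive_part_def using sets.sigma_sets_eq[of borel] by (subst sets_measure_of) simp_all

lemma space_positive_part [simp]: "space (positive_part \<mu>) = UNIV"
  using sets_eq_imp_space_eq[OF sets_positive_part] by simp

lemma emeasure_positive_part: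
  assumes \<mu>: "\<mu> \<in> signed_measures" and A: "A \<in> sets borel"
  shows "emeasure (positive_part \<mu>) A = upper_variation \<mu> A"
proof (rule emeasure_measure_of)
  show "positive_part \<mu> = measure_of UNIV (sets borel) (upper_variation \<mu>)"
    unfolding positive_part_def upper_variation_def ..
  have "upper_variation \<mu> {} = 0"
    unfolding upper_variation_def using signed_measuresD(1)[OF \<mu>]
    by (auto simp: SUP_eq_const intro!: SUP_eqI)
  then show "positive (sets (positive_part \<mu>)) (upper_variation \<mu>)"
    by (simp add: positive_def)
qed (simp_all add: A upper_variation_countably_additive[OF \<mu>])

lemma finite_measure_positive_part:
  assumes \<mu>: "\<mu> \<in> signed_measures"
  shows "finite_measure (positive_part \<mu>)"
proof
  obtain C where C: "\<And>B. B \<in> sets borel \<Longrightarrow> \<bar>\<mu> B\<bar> \<le> C"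
    using signed_measure_bounded[OF \<mu>] by auto
  have "upper_variation \<mu> UNIV \<le> ennreal C"
    unfolding upper_variation_def using C by (intro SUP_least ennreal_leI) (auto simp: abs_le_iff)
  then show "emeasure (positive_part \<mu>) (space (positive_part \<mu>)) \<noteq> \<infinity>"
    using emeasure_positive_part[OF \<mu>, of UNIV] by (auto simp: top_unique)
qed

abbreviation negative_part :: "(real set \<Rightarrow> real) \<Rightarrow> real measure" where
  "negative_part \<mu> \<equiv> positive_part (\<lambda>A. - \<mu> A)"

lemma finite_measure_negative_part:
  "\<mu> \<in> signed_measures \<Longrightarrow> finite_measure (negative_part \<mu>)"
  by (intro finite_measure_positive_part signed_measures_uminus)

lemma measure_positive_part_least:
  assumes \<mu>: "\<mu> \<in> signed_measures" and A: "A \<in> sets borel"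
    and "\<And>B. B \<in> sets borel \<Longrightarrow> B \<subseteq> A \<Longrightarrow> \<mu> B \<le> c"
  shows "measure (positive_part \<mu>) A \<le> c"
proof -
  have "0 \<le> c" using assms(3)[of "{}"] signed_measuresD(1)[OF \<mu>] by simp
  moreover have "upper_variation \<mu> A \<le> ennreal c"
    unfolding upper_variation_def using assms(3) by (intro SUP_least ennreal_leI) auto
  ultimately show ?thesis
    unfolding measure_def emeasure_positive_part[OF \<mu> A] by (simp add: enn2real_leI)
qed

lemma measure_positive_part_upper:
  assumes \<mu>: "\<mu> \<in> signed_measures" and "A \<in> sets borel" "B \<in> sets borel" "B \<subseteq> A"
  shows "\<mu> B \<le> measure (positive_part \<mu>) A"
proof -
  interpret finite_measure "positive_part \<mu>" by (rule finite_measure_positive_part[OF \<mu>])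
  have "ennreal (\<mu> B) \<le> emeasure (positive_part \<mu>) A"
    using assms by (simp add: emeasure_positive_part upper_variation_upper)
  then show ?thesis by (simp add: emeasure_eq_measure)
qed

text \<open>
  As \<open>\<mu> B = \<mu> A - \<mu> (A - B)\<close> for \<open>B \<subseteq> A\<close>, maximizing \<open>\<mu> B\<close> and minimizing \<open>\<mu> (A - B)\<close> are
  the same task, and the two optimal values add up to \<open>\<mu> A\<close>.
\<close>

lemma jordan_decomposition:
  assumes \<mu>: "\<mu> \<in> signed_measures" and A: "A \<in> sets borel"
  shows "\<mu> A = measure (positive_part \<mu>) A - measure (negative_part \<mu>) A"
proof (rule antisym)
  note \<mu>' = signed_measures_uminus[OF \<mu>]
  have "- \<mu> B \<le> measure (positive_part \<mu>) A - \<mu> A" if "B \<in> sets borel" "B \<subseteq> A" for B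
    using measure_positive_part_upper[OF \<mu> A, of "A - B"] signed_measure_Diff[OF \<mu> A that] that A by auto
  from measure_positive_part_least[OF \<mu>' A this]
  show "\<mu> A \<le> measure (positive_part \<mu>) A - measure (negative_part \<mu>) A" by simp
  have "\<mu> B \<le> measure (negative_part \<mu>) A + \<mu> A" if "B \<in> sets borel" "B \<subseteq> A" for B
    using measure_positive_part_upper[OF \<mu>' A, of "A - B"] signed_measure_Diff[OF \<mu> A that] that A by auto
  from measure_positive_part_least[OF \<mu> A this]
  show "measure (positive_part \<mu>) A - measure (negative_part \<mu>) A \<le> \<mu> A" by simp
qed

text \<open>
  By the Jordan decomposition of \<open>\<mu> UNIV\<close> the left-hand side is the supremum of
  \<open>2 * \<mu> B - \<mu> UNIV = \<mu> B - \<mu> (- B)\<close> over all Borel sets \<open>B\<close>, and \<open>{B, - B}\<close> is one of the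
  families that define the total variation.
\<close>

lemma total_variation_ge:
  assumes \<mu>: "\<mu> \<in> signed_measures"
  shows "ennreal (measure (positive_part \<mu>) UNIV + measure (negative_part \<mu>) UNIV) \<le> total_variation \<mu>"
proof (cases "total_variation \<mu>")
  case (real v)
  have "\<mu> B \<le> (v + \<mu> UNIV) / 2" if B: "B \<in> sets borel" for B
  proof (cases "B = UNIV - B")
    case True
    then show ?thesis by auto
  next
    case False
    \<comment> \<open>the two sets differ, so that the sum over the set of both has two terms\<close>
    then have "ennreal (\<bar>\<mu> B\<bar> + \<bar>\<mu> (UNIV - B)\<bar>) = (\<Sum>A\<in>{B, UNIV - B}. ennreal \<bar>\<mu> A\<bar>)"
      by simp
    also have "\<dots> \<le> total_variation \<mu>"
      unfolding total_variation_def using B by (intro SUP_upper) (auto simp: disjoint_def)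
    finally have "\<bar>\<mu> B\<bar> + \<bar>\<mu> (UNIV - B)\<bar> \<le> v"
      using real by (simp add: ennreal_le_iff del: ennreal_plus)
    then show ?thesis using signed_measure_Diff[OF \<mu> _ B, of UNIV] by simp
  qed
  then have "measure (positive_part \<mu>) UNIV \<le> (v + \<mu> UNIV) / 2"
    by (intro measure_positive_part_least[OF \<mu>]) auto
  then show ?thesis
    using real jordan_decomposition[OF \<mu>, of UNIV] by (auto intro!: ennreal_leI simp del: ennreal_plus)
qed simp


section \<open>Duality bounds and finitely supported measures\<close>

lemma integrable_positive_part:
  fixes \<phi> :: "real \<Rightarrow> real"
  assumes "\<mu> \<in> signed_measures" "\<phi> \<in> borel_measurable borel" "\<And>t. \<bar>\<phi> t\<bar> \<le> C"
  shows "integrable (positive_part \<mu>) \<phi>"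
proof -
  interpret finite_measure "positive_part \<mu>" by (rule finite_measure_positive_part) fact
  show ?thesis
  proof (rule integrable_const_bound[of _ C])
    show "\<phi> \<in> borel_measurable (positive_part \<mu>)"
      using assms(2) by (simp cong: measurable_cong_sets)
  qed (use assms in auto)
qed

lemmas integrable_negative_part = integrable_positive_part[OF signed_measures_uminus]

lemma abs_integral_positive_part_le:
  fixes \<phi> :: "real \<Rightarrow> real"
  assumes "\<mu> \<in> signed_measures" "\<phi> \<in> borel_measurable borel" "\<And>t. \<bar>\<phi> t\<bar> \<le> C"
  shows "\<bar>LINT t|positive_part \<mu>. \<phi> t\<bar> \<le> C * measure (positive_part \<mu>) UNIV"
proof -
  interpret finite_measure "positive_part \<mu>" by (rule finite_measure_positive_part) fact
  note int = integrable_positive_part[OF assms]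
  have "\<bar>LINT t|positive_part \<mu>. \<phi> t\<bar> \<le> (LINT t|positive_part \<mu>. \<bar>\<phi> t\<bar>)"
    by (rule integral_abs_bound)
  also have "\<dots> \<le> (LINT t|positive_part \<mu>. C)"
    using int assms(3) by (intro integral_mono) auto
  finally show ?thesis by (simp add: mult.commute)
qed

lemma signed_integral_diff_le:
  assumes \<mu>: "\<mu> \<in> signed_measures" and m: "\<phi> \<in> borel_measurable borel" "\<psi> \<in> borel_measurable borel"
    and b: "\<And>t. \<bar>\<psi> t\<bar> \<le> B" "\<And>t. \<bar>\<phi> t - \<psi> t\<bar> \<le> C"
  shows "\<bar>signed_integral \<mu> \<phi> - signed_integral \<mu> \<psi>\<bar>
    \<le> C * (measure (positive_part \<mu>) UNIV + measure (negative_part \<mu>) UNIV)"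
proof -
  note \<mu>' = signed_measures_uminus[OF \<mu>]
  have b': "\<bar>\<phi> t\<bar> \<le> B + C" for t using b[of t] by linarith
  have m': "(\<lambda>t. \<phi> t - \<psi> t) \<in> borel_measurable borel" using m by measurable
  note I = integrable_positive_part[OF \<mu> m(1) b'] integrable_positive_part[OF \<mu> m(2) b(1)]
    integrable_negative_part[OF \<mu> m(1) b'] integrable_negative_part[OF \<mu> m(2) b(1)]
  have "signed_integral \<mu> \<phi> - signed_integral \<mu> \<psi>
    = (LINT t|positive_part \<mu>. \<phi> t - \<psi> t) - (LINT t|negative_part \<mu>. \<phi> t - \<psi> t)"
    unfolding signed_integral_def using I by simp
  then show ?thesis
    using abs_integral_positive_part_le[OF \<mu> m' b(2)] abs_integral_positive_part_le[OF \<mu>' m' b(2)]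
    by (simp add: algebra_simps abs_le_iff)
qed

lemma signed_integral_uniform_limit:
  assumes \<mu>: "\<mu> \<in> signed_measures"
    and m: "\<And>n. \<phi> n \<in> borel_measurable borel" "\<psi> \<in> borel_measurable borel"
    and b: "\<And>t. \<bar>\<psi> t\<bar> \<le> B" "\<And>n t. \<bar>\<phi> n t - \<psi> t\<bar> \<le> e n" and e: "e \<longlonglongrightarrow> 0"
  shows "(\<lambda>n. signed_integral \<mu> (\<phi> n)) \<longlonglongrightarrow> signed_integral \<mu> \<psi>"
proof (rule LIM_zero_cancel, rule Lim_null_comparison)
  show "\<forall>\<^sub>F n in sequentially. norm (signed_integral \<mu> (\<phi> n) - signed_integral \<mu> \<psi>)
    \<le> e n * (measure (positive_part \<mu>) UNIV + measure (negative_part \<mu>) UNIV)"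
    using signed_integral_diff_le[OF \<mu> m b] by simp
  show "(\<lambda>n. e n * (measure (positive_part \<mu>) UNIV + measure (negative_part \<mu>) UNIV)) \<longlonglongrightarrow> 0"
    using e by (rule tendsto_mult_left_zero)
qed

lemma signed_integral_le_variation:
  assumes \<mu>: "\<mu> \<in> signed_measures" and m: "\<eta> \<in> borel_measurable borel" and b: "\<And>t. \<bar>\<eta> t\<bar> \<le> 1"
  shows "ennreal (signed_integral \<mu> \<eta>) \<le> total_variation \<mu>"
proof -
  have "signed_integral \<mu> \<eta> \<le> measure (positive_part \<mu>) UNIV + measure (negative_part \<mu>) UNIV"
    using signed_integral_diff_le[OF \<mu> m, of "\<lambda>_. 0" 0 1] b by (simp add: signed_integral_def)
  then show ?thesis using total_variation_ge[OF \<mu>] by (meson ennreal_leI order_trans)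
qed

text \<open>
  In the case of equality the nonnegative functions \<open>1 - \<eta>\<close> and \<open>1 + \<eta>\<close> have integral zero
  against the positive and the negative part, respectively.
\<close>

lemma extremal_measure_null:
  assumes \<mu>: "\<mu> \<in> signed_measures" and m: "\<eta> \<in> borel_measurable borel" and b: "\<And>t. \<bar>\<eta> t\<bar> \<le> 1"
    and ext: "total_variation \<mu> \<le> ennreal (signed_integral \<mu> \<eta>)"
    and B: "B \<in> sets borel" and off: "\<And>t. t \<in> B \<Longrightarrow> \<bar>\<eta> t\<bar> \<noteq> 1"
  shows "\<mu> B = 0"
proof -
  let ?P = "positive_part \<mu>" and ?N = "negative_part \<mu>"
  interpret P: finite_measure ?P by (rule finite_measure_positive_part[OF \<mu>])
  interpret N: finite_measure ?N by (rule finite_measure_negative_part[OF \<mu>])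
  note I = integrable_positive_part[OF \<mu> m b] integrable_negative_part[OF \<mu> m b]
  have "measure ?P UNIV + measure ?N UNIV \<le> max 0 (signed_integral \<mu> \<eta>)"
    using order_trans[OF total_variation_ge[OF \<mu>] ext]
    by (auto simp: ennreal_le_iff2 max_def simp del: ennreal_plus)
  moreover have "(LINT t|?P. 1 - \<eta> t) = measure ?P UNIV - (LINT t|?P. \<eta> t)"
    "(LINT t|?N. 1 + \<eta> t) = measure ?N UNIV + (LINT t|?N. \<eta> t)"
    using I by simp_all
  moreover have nn: "0 \<le> 1 - \<eta> t" "0 \<le> 1 + \<eta> t" for t using b[of t] by linarith+
  moreover have "0 \<le> (LINT t|?P. 1 - \<eta> t)" "0 \<le> (LINT t|?N. 1 + \<eta> t)"
    using nn by simp_all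
  moreover have "\<bar>signed_integral \<mu> \<eta>\<bar> \<le> measure ?P UNIV + measure ?N UNIV"
    using signed_integral_diff_le[OF \<mu> m, of "\<lambda>_. 0" 0 1] b by (simp add: signed_integral_def)
  ultimately have "(LINT t|?P. 1 - \<eta> t) = 0" "(LINT t|?N. 1 + \<eta> t) = 0"
    unfolding signed_integral_def by linarith+
  moreover have "(LINT t|?P. 1 - \<eta> t) = 0 \<longleftrightarrow> (AE t in ?P. 1 - \<eta> t = 0)"
    "(LINT t|?N. 1 + \<eta> t) = 0 \<longleftrightarrow> (AE t in ?N. 1 + \<eta> t = 0)"
    using I nn by (intro integral_nonneg_eq_0_iff_AE; simp)+
  ultimately have ae: "AE t in ?P. 1 - \<eta> t = 0" "AE t in ?N. 1 + \<eta> t = 0"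
    by blast+
  have off': "t \<notin> B" if "1 - \<eta> t = 0 \<or> 1 + \<eta> t = 0" for t
  proof
    assume "t \<in> B"
    then show False using off[of t] that by (auto simp: abs_if split: if_splits)
  qed
  have "AE t in ?P. t \<notin> B"
    using ae(1) by (rule eventually_mono) (intro off' disjI1)
  moreover have "AE t in ?N. t \<notin> B"
    using ae(2) by (rule eventually_mono) (intro off' disjI2)
  ultimately have "measure ?P B = 0" "measure ?N B = 0"
    using B AE_iff_measurable[of B ?P "\<lambda>t. t \<notin> B"] AE_iff_measurable[of B ?N "\<lambda>t. t \<notin> B"]
    by (simp_all add: measure_def)
  then show ?thesis using jordan_decomposition[OF \<mu> B] by simp
qed

definition supported_on :: "(real set \<Rightarrow> real) \<Rightarrow> real set \<Rightarrow> bool" where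
  "supported_on \<mu> S \<longleftrightarrow> (\<forall>B\<in>sets borel. B \<inter> S = {} \<longrightarrow> \<mu> B = 0)"

text \<open>
  Off \<open>S\<close> there is no mass, so \<open>\<phi>\<close> may be replaced by the simple function with the same values on
  \<open>S\<close>.
\<close>

lemma integral_positive_part_finite_support:
  assumes \<mu>: "\<mu> \<in> signed_measures" and S: "finite S" "supported_on \<mu> S"
    and m: "\<phi> \<in> borel_measurable borel"
  shows "(LINT t|positive_part \<mu>. \<phi> t) = (\<Sum>s\<in>S. \<phi> s * measure (positive_part \<mu>) {s})"
proof -
  let ?P = "positive_part \<mu>"
  interpret finite_measure ?P by (rule finite_measure_positive_part[OF \<mu>])
  have "S \<in> sets borel" using S(1) by (simp add: finite_imp_closed borel_closed)
  then have c: "- S \<in> sets borel" by auto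
  have "measure ?P (- S) \<le> 0"
    using S(2) unfolding supported_on_def by (intro measure_positive_part_least[OF \<mu> c]) auto
  then have "emeasure ?P (- S) = 0"
    by (simp add: emeasure_eq_measure measure_le_0_iff)
  then have "AE t in ?P. t \<notin> - S"
    using c by (subst AE_iff_measurable[OF _ refl]) (simp_all add: Compl_eq)
  then have "AE t in ?P. \<phi> t = (\<Sum>s\<in>S. \<phi> s * indicator {s} t)"
    by (rule eventually_mono) (use S(1) in \<open>auto simp: indicator_def if_distrib sum.delta' cong: if_cong\<close>)
  then have "(LINT t|?P. \<phi> t) = (LINT t|?P. (\<Sum>s\<in>S. \<phi> s * indicator {s} t))"
    using m by (intro integral_cong_AE) (auto cong: measurable_cong_sets)
  also have "\<dots> = (\<Sum>s\<in>S. \<phi> s * measure ?P {s})"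
    by (subst Bochner_Integration.integral_sum) (auto simp: emeasure_eq_measure)
  finally show ?thesis .
qed

lemma signed_integral_finite_support:
  assumes \<mu>: "\<mu> \<in> signed_measures" and S: "finite S" "supported_on \<mu> S"
    and m: "\<phi> \<in> borel_measurable borel"
  shows "signed_integral \<mu> \<phi> = (\<Sum>s\<in>S. \<phi> s * \<mu> {s})"
proof -
  have S': "supported_on (\<lambda>A. - \<mu> A) S" using S(2) unfolding supported_on_def by simp
  show ?thesis
    unfolding signed_integral_def integral_positive_part_finite_support[OF \<mu> S m]
      integral_positive_part_finite_support[OF signed_measures_uminus[OF \<mu>] S(1) S' m]
    by (simp add: jordan_decomposition[OF \<mu>] algebra_simps flip: sum_subtractf)
qed

text \<open>
  The points \<open>s i\<close> may coincide. Non-Borel sets get the value 0, as for every element of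
  \<^const>\<open>signed_measures\<close>.
\<close>

definition dirac_sum :: "'i set \<Rightarrow> ('i \<Rightarrow> real) \<Rightarrow> ('i \<Rightarrow> real) \<Rightarrow> real set \<Rightarrow> real" where
  "dirac_sum I b s A = (if A \<in> sets borel then \<Sum>i\<in>I. b i * indicator A (s i) else 0)"

lemma dirac_sum_signed_measures: "dirac_sum I b s \<in> signed_measures"
proof -
  have "(\<lambda>n. dirac_sum I b s (A n)) sums dirac_sum I b s (\<Union>n. A n)"
    if A: "range A \<subseteq> sets borel" "disjoint_family A" for A :: "nat \<Rightarrow> real set"
  proof -
    have "(\<lambda>n. \<Sum>i\<in>I. b i * indicator (A n) (s i)) sums (\<Sum>i\<in>I. b i * indicator (\<Union>n. A n) (s i))"
      using A(2) by (intro sums_sum sums_mult indicator_sums) (auto simp: disjoint_family_on_def)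
    moreover have "A n \<in> sets borel" "(\<Union>n. A n) \<in> sets borel" for n
      using A(1) by auto
    ultimately show ?thesis unfolding dirac_sum_def by simp
  qed
  then show ?thesis unfolding signed_measures_def by (simp add: dirac_sum_def)
qed

lemma total_variation_dirac_sum: "total_variation (dirac_sum I b s) \<le> ennreal (\<Sum>i\<in>I. \<bar>b i\<bar>)"
  unfolding total_variation_def
proof (rule SUP_least, safe)
  fix P :: "real set set" assume P: "finite P" "P \<subseteq> sets borel" "disjoint P"
  have one: "(\<Sum>A\<in>P. indicator A t) \<le> (1::real)" for t :: real
  proof (cases "\<exists>A\<in>P. t \<in> A")
    case True
    then obtain A where A: "A \<in> P" "t \<in> A" by auto
    have "indicator A' t = (if A' = A then 1 else (0::real))" if "A' \<in> P" for A'
    proof (cases "A' = A")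
      case False
      then have "A' \<inter> A = {}" by (rule disjointD[OF P(3) that A(1)])
      then have "t \<notin> A'" using A(2) by auto
      then show ?thesis using False by simp
    qed (simp add: A(2))
    then have "(\<Sum>A'\<in>P. indicator A' t) = (\<Sum>A'\<in>P. if A' = A then 1 else (0::real))"
      by (intro sum.cong) auto
    then show ?thesis using P(1) by simp
  next
    case False
    then have "(\<Sum>A\<in>P. indicator A t) = (0::real)" by (intro sum.neutral) auto
    then show ?thesis by simp
  qed
  have "(\<Sum>A\<in>P. \<bar>dirac_sum I b s A\<bar>) \<le> (\<Sum>A\<in>P. \<Sum>i\<in>I. \<bar>b i\<bar> * indicator A (s i))"
  proof (rule sum_mono)
    fix A assume "A \<in> P"
    then have "\<bar>dirac_sum I b s A\<bar> \<le> (\<Sum>i\<in>I. \<bar>b i * indicator A (s i)\<bar>)"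
      using P(2) unfolding dirac_sum_def by auto
    then show "\<bar>dirac_sum I b s A\<bar> \<le> (\<Sum>i\<in>I. \<bar>b i\<bar> * indicator A (s i))"
      by (simp add: abs_mult)
  qed
  also have "\<dots> = (\<Sum>i\<in>I. \<bar>b i\<bar> * (\<Sum>A\<in>P. indicator A (s i)))"
    by (subst sum.swap) (simp add: sum_distrib_left)
  also have "\<dots> \<le> (\<Sum>i\<in>I. \<bar>b i\<bar> * 1)"
    by (intro sum_mono mult_left_mono one) simp
  finally show "(\<Sum>A\<in>P. ennreal \<bar>dirac_sum I b s A\<bar>) \<le> ennreal (\<Sum>i\<in>I. \<bar>b i\<bar>)"
    by (simp add: ennreal_leI)
qed

lemma signed_integral_dirac_sum:
  assumes "finite I" and m: "\<phi> \<in> borel_measurable borel"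
  shows "signed_integral (dirac_sum I b s) \<phi> = (\<Sum>i\<in>I. b i * \<phi> (s i))"
proof -
  have "supported_on (dirac_sum I b s) (s ` I)"
    unfolding supported_on_def dirac_sum_def by (auto intro!: sum.neutral simp: indicator_def)
  then have "signed_integral (dirac_sum I b s) \<phi> = (\<Sum>t\<in>s ` I. \<phi> t * dirac_sum I b s {t})"
    using assms by (intro signed_integral_finite_support[OF dirac_sum_signed_measures]) auto
  also have "\<dots> = (\<Sum>t\<in>s ` I. \<Sum>i\<in>{i \<in> I. s i = t}. b i * \<phi> (s i))"
  proof (rule sum.cong)
    fix t
    have "(\<Sum>i\<in>I. b i * indicator {t} (s i)) = (\<Sum>i\<in>{i \<in> I. s i = t}. b i)"
      using assms(1) by (intro sum.mono_neutral_cong_right) auto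
    then show "\<phi> t * dirac_sum I b s {t} = (\<Sum>i\<in>{i \<in> I. s i = t}. b i * \<phi> (s i))"
      by (simp add: dirac_sum_def sum_distrib_left mult.commute)
  qed simp
  also have "\<dots> = (\<Sum>i\<in>I. b i * \<phi> (s i))"
    using assms(1) by (rule sum.image_gen[symmetric])
  finally show ?thesis .
qed

section \<open>Softplus functions as smooth ramps\<close>

text \<open>
  Exponential decay beats every power of \<open>t\<close>, since \<open>x ^ n \<le> fact n * exp x\<close>. Supplying the
  derivatives as a sequence \<open>F\<close> saves computing \<^const>\<open>deriv\<close> by hand.
\<close>

lemma schwartz_spaceI_exp_decay:
  fixes F :: "nat \<Rightarrow> real \<Rightarrow> real"
  assumes D: "\<And>n t. (F n has_field_derivative F (Suc n) t) (at t)" and \<kappa>: "\<kappa> > 0"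
    and decay: "\<And>n. \<exists>C. \<forall>t. \<bar>F n t\<bar> \<le> C * exp (- \<kappa> * \<bar>t\<bar>)"
  shows "F 0 \<in> schwartz_space"
proof -
  have F: "(deriv ^^ n) (F 0) = F n" for n
    by (induction n) (auto intro: DERIV_imp_deriv D)
  have power_le: "x ^ n \<le> fact n * exp x" if "x \<ge> 0" for x :: real and n
  proof -
    have "(\<Sum>i\<in>{n}. x ^ i /\<^sub>R fact i) \<le> exp x"
      unfolding exp_def using that by (intro sum_le_suminf summable_exp_generic) auto
    then show ?thesis by (simp add: field_simps)
  qed
  have "bounded (range (\<lambda>t. t ^ k * F n t))" for k n
  proof -
    obtain C where C: "\<And>t. \<bar>F n t\<bar> \<le> C * exp (- \<kappa> * \<bar>t\<bar>)" using decay by blast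
    have "\<bar>t ^ k * F n t\<bar> \<le> fact k / \<kappa> ^ k * C" for t
    proof -
      have "\<bar>t\<bar> ^ k \<le> fact k / \<kappa> ^ k * exp (\<kappa> * \<bar>t\<bar>)"
        using power_le[of "\<kappa> * \<bar>t\<bar>" k] \<kappa> by (simp add: field_simps power_mult_distrib)
      then have "\<bar>t\<bar> ^ k * \<bar>F n t\<bar> \<le> (fact k / \<kappa> ^ k * exp (\<kappa> * \<bar>t\<bar>)) * (C * exp (- \<kappa> * \<bar>t\<bar>))"
        using C[of t] \<kappa> by (intro mult_mono) auto
      also have "\<dots> = fact k / \<kappa> ^ k * C" by (simp flip: exp_add)
      finally show ?thesis by (simp add: abs_mult power_abs)
    qed
    then show ?thesis by (auto simp: bounded_iff)
  qed
  moreover have "F n differentiable_on UNIV" for n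
    using D by (auto simp: differentiable_on_def real_differentiable_def intro: has_field_derivative_at_within)
  ultimately show ?thesis unfolding schwartz_space_def by (simp add: F)
qed

definition sigmoid :: "real \<Rightarrow> real" where "sigmoid u = 1 / (1 + exp (- u))"

definition softplus :: "real \<Rightarrow> real" where "softplus u = ln (1 + exp u)"

lemma one_plus_exp_pos: "0 < 1 + exp (u::real)"
  by (simp add: add_pos_pos)

lemma sigmoid_bounds: "0 < sigmoid u" "sigmoid u < 1" "sigmoid u \<le> exp u"
  using one_plus_exp_pos[of "-u"] unfolding sigmoid_def
  by (auto simp: divide_simps exp_minus)

lemma sigmoid_minus: "sigmoid (- u) = 1 - sigmoid u"
  using one_plus_exp_pos[of u] unfolding sigmoid_def
  by (simp add: field_simps exp_minus)

lemma DERIV_sigmoid: "(sigmoid has_field_derivative sigmoid u * (1 - sigmoid u)) (at u)"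
proof -
  have "(sigmoid has_field_derivative exp (- u) / (1 + exp (- u))\<^sup>2) (at u)"
    unfolding sigmoid_def[abs_def] using one_plus_exp_pos[of "-u"]
    by (auto intro!: derivative_eq_intros simp: power2_eq_square)
  moreover have "sigmoid u * (1 - sigmoid u) = exp (- u) / (1 + exp (- u))\<^sup>2"
    using one_plus_exp_pos[of "-u"] unfolding sigmoid_def
    by (simp add: field_simps power2_eq_square)
  ultimately show ?thesis by simp
qed

lemma sigmoid_density_upper: "sigmoid u * (1 - sigmoid u) \<le> exp (- \<bar>u\<bar>)"
proof -
  have "sigmoid u * sigmoid (- u) \<le> exp (- \<bar>u\<bar>)"
  proof (cases "u \<ge> 0")
    case True
    have "sigmoid u * sigmoid (- u) \<le> 1 * exp (- u)"
      using sigmoid_bounds[of u] sigmoid_bounds[of "-u"] by (intro mult_mono) auto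
    with True show ?thesis by simp
  next
    case False
    have "sigmoid u * sigmoid (- u) \<le> exp u * 1"
      using sigmoid_bounds[of u] sigmoid_bounds[of "-u"] by (intro mult_mono) auto
    with False show ?thesis by simp
  qed
  then show ?thesis by (simp add: sigmoid_minus)
qed

lemma sigmoid_density_lower: "exp (- \<bar>u\<bar>) \<le> 4 * (sigmoid u * (1 - sigmoid u))"
proof -
  have "exp (- v) \<le> 4 * (sigmoid v * sigmoid (- v))" if "v \<ge> 0" for v
  proof -
    have "1 \<le> 2 * sigmoid v" using that unfolding sigmoid_def by (simp add: divide_simps add_pos_pos)
    moreover have "exp (- v) \<le> 2 * sigmoid (- v)"
    proof -
      have "exp (-v) * (1 + exp v) \<le> 2" using that by (simp add: distrib_left flip: exp_add)
      then show ?thesis unfolding sigmoid_def by (simp add: field_simps add_pos_pos)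
    qed
    ultimately have "1 * exp (- v) \<le> (2 * sigmoid v) * (2 * sigmoid (- v))"
      by (intro mult_mono) auto
    then show ?thesis by simp
  qed
  from this[of "\<bar>u\<bar>"] show ?thesis by (cases "u \<ge> 0") (simp_all add: sigmoid_minus mult.commute)
qed

lemma DERIV_softplus: "(softplus has_field_derivative sigmoid u) (at u)"
proof -
  have "(softplus has_field_derivative exp u / (1 + exp u)) (at u)"
    unfolding softplus_def[abs_def] using one_plus_exp_pos[of u]
    by (auto intro!: derivative_eq_intros)
  moreover have "exp u / (1 + exp u) = sigmoid u"
    unfolding sigmoid_def by (simp add: field_simps add_pos_pos exp_minus)
  ultimately show ?thesis by simp
qed

lemma softplus_minus: "softplus u = u + softplus (- u)"
proof -
  have "1 + exp u = exp u * (1 + exp (- u))" by (simp add: distrib_left flip: exp_add)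
  then show ?thesis unfolding softplus_def using one_plus_exp_pos[of "-u"]
    by (simp add: ln_mult_pos)
qed

lemma softplus_bounds: "0 \<le> softplus u" "softplus u \<le> exp u"
  unfolding softplus_def by (auto intro: ln_add_one_self_le_self)

lemma softplus_approx: "\<bar>softplus u - max 0 u\<bar> \<le> ln 2"
proof -
  have *: "softplus v \<le> ln 2" if "v \<le> 0" for v
    unfolding softplus_def using that by (intro ln_mono) (auto simp: add_pos_pos)
  show ?thesis
    using *[of u] *[of "-u"] softplus_bounds(1)[of u] softplus_bounds(1)[of "-u"] softplus_minus[of u]
    by (cases "u \<le> 0") (auto simp: abs_le_iff)
qed

text \<open>
  As \<open>sigmoid' = sigmoid * (1 - sigmoid)\<close>, every derivative of the sigmoid is a polynomial in the
  sigmoid; this is the polynomial of the \<open>n\<close>-th derivative. From \<open>n = 1\<close> on it is divisible by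
  \<open>X * (1 - X)\<close>, which is where the exponential decay comes from.
\<close>

primrec sigmoid_poly :: "nat \<Rightarrow> real poly" where
  "sigmoid_poly 0 = [:0, 1:]"
| "sigmoid_poly (Suc n) = pderiv (sigmoid_poly n) * [:0, 1, -1:]"

fun softplus_deriv :: "nat \<Rightarrow> real \<Rightarrow> real" where
  "softplus_deriv 0 u = softplus u"
| "softplus_deriv (Suc n) u = poly (sigmoid_poly n) (sigmoid u)"

lemma softplus_deriv_2: "softplus_deriv (Suc (Suc 0)) u = sigmoid u * (1 - sigmoid u)"
  by (simp add: pderiv_pCons algebra_simps)

lemma DERIV_softplus_deriv: "(softplus_deriv n has_field_derivative softplus_deriv (Suc n) u) (at u)"
proof (cases n)
  case 0
  moreover have "softplus_deriv 0 = softplus" by (simp add: fun_eq_iff)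
  ultimately show ?thesis using DERIV_softplus by simp
next
  case (Suc m)
  have "((\<lambda>u. poly (sigmoid_poly m) (sigmoid u)) has_field_derivative
      poly (pderiv (sigmoid_poly m)) (sigmoid u) * (sigmoid u * (1 - sigmoid u))) (at u)"
    by (rule DERIV_chain2[OF poly_DERIV DERIV_sigmoid])
  moreover have "softplus_deriv n = (\<lambda>u. poly (sigmoid_poly m) (sigmoid u))"
    using Suc by (simp add: fun_eq_iff)
  ultimately show ?thesis using Suc by (simp add: algebra_simps)
qed

lemma softplus_deriv_decay: "\<exists>C\<ge>0. \<forall>u. \<bar>softplus_deriv (Suc (Suc n)) u\<bar> \<le> C * exp (- \<bar>u\<bar>)"
proof -
  let ?q = "pderiv (sigmoid_poly n)"
  have "compact ((\<lambda>s. poly ?q s) ` {0..1})"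
    by (intro compact_continuous_image continuous_intros) auto
  then have "bounded ((\<lambda>s. poly ?q s) ` {0..1})" by (rule compact_imp_bounded)
  then have "\<exists>C. \<forall>s\<in>{0..1}. \<bar>poly ?q s\<bar> \<le> C"
    unfolding bounded_iff by auto
  then obtain C where C: "\<And>s. s \<in> {0..1} \<Longrightarrow> \<bar>poly ?q s\<bar> \<le> C"
    by blast
  have C0: "C \<ge> 0" using C[of 0] by simp
  have "\<bar>softplus_deriv (Suc (Suc n)) u\<bar> \<le> C * exp (- \<bar>u\<bar>)" for u
  proof -
    have s: "0 < sigmoid u" "sigmoid u < 1" by (rule sigmoid_bounds)+
    have "\<bar>softplus_deriv (Suc (Suc n)) u\<bar> = \<bar>poly ?q (sigmoid u) * (sigmoid u * (1 - sigmoid u))\<bar>"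
      by (simp add: algebra_simps)
    also have "\<dots> = \<bar>poly ?q (sigmoid u)\<bar> * (sigmoid u * (1 - sigmoid u))"
      using s by (simp add: abs_mult)
    also have "\<dots> \<le> C * exp (- \<bar>u\<bar>)"
      using s C0 by (intro mult_mono C sigmoid_density_upper) auto
    finally show ?thesis .
  qed
  then show ?thesis using C0 by blast
qed

text \<open>
  At \<open>-\<infinity>\<close> the softplus function and all its derivatives decay exponentially; at \<open>+\<infinity>\<close> they
  approach those of the identity, here called \<open>h\<close>.
\<close>

lemma softplus_deriv_tails:
  defines "h \<equiv> \<lambda>n u. if n = 0 then u else if n = Suc 0 then 1 else (0::real)"
  shows "\<exists>C\<ge>0. \<forall>u. \<bar>softplus_deriv n u\<bar> \<le> C * exp u \<and> \<bar>softplus_deriv n u - h n u\<bar> \<le> C * exp (- u)"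
proof -
  show ?thesis
  proof (cases n)
    case 0
    have "\<bar>softplus u\<bar> \<le> exp u" "\<bar>softplus u - u\<bar> \<le> exp (- u)" for u
      using softplus_bounds[of u] softplus_bounds[of "-u"] softplus_minus[of u] by simp_all
    with 0 show ?thesis by (intro exI[of _ 1]) (simp add: h_def)
  next
    case (Suc n')
    show ?thesis
    proof (cases n')
      case 0
      have "\<bar>sigmoid u\<bar> \<le> exp u" "\<bar>sigmoid u - 1\<bar> \<le> exp (- u)" for u
        using sigmoid_bounds[of u] sigmoid_bounds[of "-u"] sigmoid_minus[of u] by simp_all
      with 0 Suc show ?thesis by (intro exI[of _ 1]) (simp add: h_def)
    next
      case (Suc m)
      obtain C where C: "C \<ge> 0" "\<And>u. \<bar>softplus_deriv n u\<bar> \<le> C * exp (- \<bar>u\<bar>)"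
        using softplus_deriv_decay[of m] \<open>n = Suc n'\<close> Suc by auto
      have "C * exp (- \<bar>u\<bar>) \<le> C * exp u" "C * exp (- \<bar>u\<bar>) \<le> C * exp (- u)" for u
        using C(1) by (auto intro!: mult_left_mono)
      moreover have "h n = (\<lambda>u. 0)" unfolding h_def using \<open>n = Suc n'\<close> Suc by auto
      ultimately show ?thesis using C by (intro exI[of _ C]) (auto intro: order_trans)
    qed
  qed
qed

lemma DERIV_softplus_deriv_rescaled:
  "((\<lambda>t. softplus_deriv n (k * (p - t))) has_field_derivative - k * softplus_deriv (Suc n) (k * (p - t))) (at t)"
proof -
  have "((\<lambda>t. k * (p - t)) has_field_derivative - k) (at t)"
    by (auto intro!: derivative_eq_intros)
  from DERIV_chain2[OF DERIV_softplus_deriv this] show ?thesis by (simp add: mult.commute)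
qed

text \<open>
  The softplus analogue, at sharpness \<open>k\<close>, of the function \<open>\<Sum>i\<in>I. c i * max 0 (p i - t)\<close>.
\<close>

definition soft_eta :: "real \<Rightarrow> 'i set \<Rightarrow> ('i \<Rightarrow> real) \<Rightarrow> ('i \<Rightarrow> real) \<Rightarrow> real \<Rightarrow> real" where
  "soft_eta k I c p t = (\<Sum>i\<in>I. c i * softplus (k * (p i - t))) / k"

text \<open>
  The second derivative of \<open>softplus (k * (p - t)) / k\<close>: a probability density of width \<open>1 / k\<close>
  around \<open>p\<close>.
\<close>

definition bump :: "real \<Rightarrow> real \<Rightarrow> real \<Rightarrow> real" where
  "bump k p t = k * (sigmoid (k * (p - t)) * (1 - sigmoid (k * (p - t))))"

text \<open>
  For \<open>t \<rightarrow> +\<infinity>\<close> each summand decays by itself. For \<open>t \<rightarrow> -\<infinity>\<close> each summand is affine up to an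
  exponentially small error, and the two conditions on \<open>c\<close> make the affine parts cancel.
\<close>

lemma soft_eta_schwartz:
  assumes I: "finite I" "(\<Sum>i\<in>I. c i) = 0" "(\<Sum>i\<in>I. c i * p i) = 0" and k: "k > 0"
  shows "soft_eta k I c p \<in> schwartz_space"
    and "deriv (deriv (soft_eta k I c p)) = (\<lambda>t. \<Sum>i\<in>I. c i * bump k (p i) t)"
proof -
  define F where "F n t = (-k) ^ n / k * (\<Sum>i\<in>I. c i * softplus_deriv n (k * (p i - t)))" for n t
  have F0: "soft_eta k I c p = F 0" by (simp add: F_def soft_eta_def fun_eq_iff)
  have D: "(F n has_field_derivative F (Suc n) t) (at t)" for n t
  proof -
    have "(F n has_field_derivative (-k) ^ n / k * (\<Sum>i\<in>I. c i * (- k * softplus_deriv (Suc n) (k * (p i - t))))) (at t)"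
      unfolding F_def[abs_def]
      by (intro DERIV_cmult DERIV_sum DERIV_softplus_deriv_rescaled)
    moreover have "(-k) ^ n / k * (\<Sum>i\<in>I. c i * (- k * softplus_deriv (Suc n) (k * (p i - t)))) = F (Suc n) t"
      unfolding F_def sum_distrib_left by (intro sum.cong) simp_all
    ultimately show ?thesis by simp
  qed
  have "\<exists>C. \<forall>t. \<bar>F n t\<bar> \<le> C * exp (- k * \<bar>t\<bar>)" for n
  proof -
    define h where "h u = (if n = 0 then u else if n = Suc 0 then 1 else (0::real))" for u
    obtain C where C: "C \<ge> 0" "\<And>u. \<bar>softplus_deriv n u\<bar> \<le> C * exp u"
        "\<And>u. \<bar>softplus_deriv n u - h u\<bar> \<le> C * exp (- u)"
      using softplus_deriv_tails[of n] unfolding h_def by blast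
    define B where "B = (\<Sum>i\<in>I. \<bar>c i\<bar> * (C * exp (k * \<bar>p i\<bar>)))"
    have h0: "(\<Sum>i\<in>I. c i * h (k * (p i - t))) = 0" for t
    proof -
      have "(\<Sum>i\<in>I. c i * (k * (p i - t))) = k * (\<Sum>i\<in>I. c i * p i) - k * t * (\<Sum>i\<in>I. c i)"
        by (simp add: sum_distrib_left sum_subtractf algebra_simps)
      then have "(\<Sum>i\<in>I. c i * (k * (p i - t))) = 0" using I by simp
      then show ?thesis using I unfolding h_def by (cases "n = 0"; cases "n = Suc 0") auto
    qed
    have "\<bar>\<Sum>i\<in>I. c i * softplus_deriv n (k * (p i - t))\<bar> \<le> B * exp (- k * \<bar>t\<bar>)" for t
    proof -
      \<comment> \<open>what is left of each summand after removing the affine part on the side where it lives\<close>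
      define g where "g u = (if t \<ge> 0 then softplus_deriv n u else softplus_deriv n u - h u)" for u
      have "(\<Sum>i\<in>I. c i * softplus_deriv n (k * (p i - t))) = (\<Sum>i\<in>I. c i * g (k * (p i - t)))"
        using h0[of t] by (cases "t \<ge> 0") (simp_all add: g_def right_diff_distrib sum_subtractf)
      also have "\<bar>\<dots>\<bar> \<le> (\<Sum>i\<in>I. \<bar>c i\<bar> * \<bar>g (k * (p i - t))\<bar>)"
        by (rule order_trans[OF sum_abs]) (simp add: abs_mult)
      also have "\<dots> \<le> (\<Sum>i\<in>I. \<bar>c i\<bar> * (C * exp (k * \<bar>p i\<bar>) * exp (- k * \<bar>t\<bar>)))"
      proof (intro sum_mono mult_left_mono)
        fix i
        have "\<bar>g (k * (p i - t))\<bar> \<le> C * exp (k * \<bar>p i\<bar> - k * \<bar>t\<bar>)"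
        proof (cases "t \<ge> 0")
          case True
          then have "k * (p i - t) \<le> k * \<bar>p i\<bar> - k * \<bar>t\<bar>"
            using k by (simp add: right_diff_distrib)
          then have "C * exp (k * (p i - t)) \<le> C * exp (k * \<bar>p i\<bar> - k * \<bar>t\<bar>)"
            using C(1) by (intro mult_left_mono) auto
          then show ?thesis using C(2)[of "k * (p i - t)"] True unfolding g_def by simp
        next
          case False
          then have "- (k * (p i - t)) \<le> k * \<bar>p i\<bar> - k * \<bar>t\<bar>"
            using k mult_left_mono[of "- p i" "\<bar>p i\<bar>" k] by (simp add: right_diff_distrib)
          then have "C * exp (- (k * (p i - t))) \<le> C * exp (k * \<bar>p i\<bar> - k * \<bar>t\<bar>)"
            using C(1) by (intro mult_left_mono) auto
          then show ?thesis using C(3)[of "k * (p i - t)"] False unfolding g_def by simp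
        qed
        then show "\<bar>g (k * (p i - t))\<bar> \<le> C * exp (k * \<bar>p i\<bar>) * exp (- k * \<bar>t\<bar>)"
          by (simp add: mult.assoc flip: exp_add)
      qed simp
      also have "\<dots> = B * exp (- k * \<bar>t\<bar>)" unfolding B_def sum_distrib_right by (simp add: mult.assoc)
      finally show ?thesis .
    qed
    then have "\<bar>F n t\<bar> \<le> (k ^ n / k * B) * exp (- k * \<bar>t\<bar>)" for t
      using k mult_left_mono[of _ _ "k ^ n / k"] by (simp add: F_def abs_mult power_abs mult.assoc)
    then show ?thesis by blast
  qed
  with D k show "soft_eta k I c p \<in> schwartz_space"
    unfolding F0 by (rule schwartz_spaceI_exp_decay)
  have deriv_F: "deriv (F n) = F (Suc n)" for n
    using DERIV_imp_deriv[OF D] by (simp add: fun_eq_iff)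
  have "deriv (deriv (soft_eta k I c p)) = F (Suc (Suc 0))"
    unfolding F0 by (simp add: deriv_F)
  also have "\<dots> = (\<lambda>t. \<Sum>i\<in>I. c i * bump k (p i) t)"
    using k unfolding F_def bump_def softplus_deriv_2 by (simp add: sum_distrib_left mult_ac)
  finally show "deriv (deriv (soft_eta k I c p)) = (\<lambda>t. \<Sum>i\<in>I. c i * bump k (p i) t)" .
qed

lemma bump_schwartz:
  assumes k: "k > 0"
  shows "bump k p \<in> schwartz_space"
proof -
  define F where "F n t = k * (-k) ^ n * softplus_deriv (Suc (Suc n)) (k * (p - t))" for n t
  have F0: "bump k p = F 0" unfolding F_def bump_def softplus_deriv_2 by simp
  have D: "(F n has_field_derivative F (Suc n) t) (at t)" for n t
  proof -
    have "(F n has_field_derivative k * (-k) ^ n * (- k * softplus_deriv (Suc (Suc (Suc n))) (k * (p - t)))) (at t)"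
      unfolding F_def[abs_def] by (intro DERIV_cmult DERIV_softplus_deriv_rescaled)
    then show ?thesis by (simp add: F_def mult_ac del: softplus_deriv.simps)
  qed
  have "\<exists>C. \<forall>t. \<bar>F n t\<bar> \<le> C * exp (- k * \<bar>t\<bar>)" for n
  proof -
    obtain C where C: "C \<ge> 0" "\<And>u. \<bar>softplus_deriv (Suc (Suc n)) u\<bar> \<le> C * exp (- \<bar>u\<bar>)"
      using softplus_deriv_decay by blast
    have "\<bar>F n t\<bar> \<le> (k * k ^ n * C * exp (k * \<bar>p\<bar>)) * exp (- k * \<bar>t\<bar>)" for t
    proof -
      have "k * \<bar>t\<bar> \<le> k * (\<bar>p\<bar> + \<bar>p - t\<bar>)" using k by (intro mult_left_mono) auto
      then have "exp (- \<bar>k * (p - t)\<bar>) \<le> exp (k * \<bar>p\<bar> - k * \<bar>t\<bar>)"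
        using k by (simp add: abs_mult distrib_left)
      then have "\<bar>softplus_deriv (Suc (Suc n)) (k * (p - t))\<bar> \<le> C * (exp (k * \<bar>p\<bar>) * exp (- k * \<bar>t\<bar>))"
        using C(2)[of "k * (p - t)"] mult_left_mono[OF _ C(1)] by (fastforce simp flip: exp_add)
      then have "k * k ^ n * \<bar>softplus_deriv (Suc (Suc n)) (k * (p - t))\<bar> \<le> k * k ^ n * (C * (exp (k * \<bar>p\<bar>) * exp (- k * \<bar>t\<bar>)))"
        using k by (intro mult_left_mono) auto
      then show ?thesis using k unfolding F_def by (simp add: abs_mult power_abs mult.assoc)
    qed
    then show ?thesis by blast
  qed
  with D k show ?thesis unfolding F0 by (rule schwartz_spaceI_exp_decay)
qed

section \<open>The bumps as an approximate identity\<close>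

lemma schwartz_spaceD:
  assumes "\<phi> \<in> schwartz_space"
  shows "\<And>n t. ((deriv ^^ n) \<phi> has_field_derivative (deriv ^^ Suc n) \<phi> t) (at t)"
    and "\<And>k n. \<exists>C. \<forall>t. \<bar>t ^ k * (deriv ^^ n) \<phi> t\<bar> \<le> C"
proof -
  fix n t
  have "(deriv ^^ n) \<phi> differentiable at t"
    using assms unfolding schwartz_space_def differentiable_on_def by auto
  then show "((deriv ^^ n) \<phi> has_field_derivative (deriv ^^ Suc n) \<phi> t) (at t)"
    by (simp add: DERIV_deriv_iff_real_differentiable)
next
  fix k n
  have "bounded (range (\<lambda>t. t ^ k * (deriv ^^ n) \<phi> t))" using assms unfolding schwartz_space_def by auto
  then show "\<exists>C. \<forall>t. \<bar>t ^ k * (deriv ^^ n) \<phi> t\<bar> \<le> C" unfolding bounded_iff by auto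
qed

lemma schwartz_continuous:
  assumes "\<phi> \<in> schwartz_space"
  shows "isCont ((deriv ^^ n) \<phi>) t" "continuous_on UNIV \<phi>" "\<phi> \<in> borel_measurable borel"
proof -
  have c: "isCont ((deriv ^^ n) \<phi>) t" for n t
    by (rule DERIV_isCont[OF schwartz_spaceD(1)[OF assms]])
  then show "isCont ((deriv ^^ n) \<phi>) t" .
  show "continuous_on UNIV \<phi>" using c[where n = 0] by (simp add: continuous_at_imp_continuous_on)
  then show "\<phi> \<in> borel_measurable borel" by (rule borel_measurable_continuous_onI)
qed

lemma schwartz_deriv_deriv:
  assumes "\<phi> \<in> schwartz_space"
  shows "deriv (deriv \<phi>) \<in> schwartz_space"
proof -
  have "(deriv ^^ n) (deriv (deriv \<phi>)) = (deriv ^^ Suc (Suc n)) \<phi>" for n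
    by (simp add: funpow_swap1)
  then show ?thesis using assms unfolding schwartz_space_def by (simp del: funpow.simps)
qed

lemma soft_eta_approx:
  assumes k: "k > 0"
  shows "\<bar>soft_eta k I c p t - (\<Sum>i\<in>I. c i * max 0 (p i - t))\<bar> \<le> (\<Sum>i\<in>I. \<bar>c i\<bar>) * ln 2 / k"
proof -
  have *: "\<bar>softplus (k * (p i - t)) / k - max 0 (p i - t)\<bar> \<le> ln 2 / k" for i
  proof -
    have "max 0 (k * (p i - t)) = k * max 0 (p i - t)"
      using k by (simp add: max_def zero_le_mult_iff)
    then have "softplus (k * (p i - t)) / k - max 0 (p i - t) = (softplus (k * (p i - t)) - max 0 (k * (p i - t))) / k"
      using k by (simp add: field_simps)
    then show ?thesis using softplus_approx[of "k * (p i - t)"] k by (simp add: divide_right_mono)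
  qed
  have "soft_eta k I c p t - (\<Sum>i\<in>I. c i * max 0 (p i - t))
    = (\<Sum>i\<in>I. c i * (softplus (k * (p i - t)) / k - max 0 (p i - t)))"
    unfolding soft_eta_def by (simp add: sum_divide_distrib right_diff_distrib sum_subtractf)
  also have "\<bar>\<dots>\<bar> \<le> (\<Sum>i\<in>I. \<bar>c i\<bar> * (ln 2 / k))"
    unfolding abs_mult[symmetric] using mult_left_mono[OF *, of "\<bar>c _\<bar>"]
    by (intro order_trans[OF sum_abs] sum_mono) (simp add: abs_mult)
  finally show ?thesis by (simp add: sum_distrib_right sum_divide_distrib)
qed

lemma bump_pos: "k > 0 \<Longrightarrow> bump k p t > 0"
  unfolding bump_def using sigmoid_bounds[of "k * (p - t)"] by simp

lemma abs_bump: "k > 0 \<Longrightarrow> \<bar>bump k p t\<bar> = bump k p t"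
  using bump_pos[of k p t] by simp

lemma bump_integral:
  assumes k: "k > 0"
  shows "integrable lborel (bump k p)" "(LINT t|lborel. bump k p t) = 1"
proof -
  have D: "((\<lambda>t. - sigmoid (k * (p - t))) has_field_derivative bump k p t) (at t)" for t
  proof -
    have "((\<lambda>t. k * (p - t)) has_field_derivative - k) (at t)"
      by (auto intro!: derivative_eq_intros)
    from DERIV_minus[OF DERIV_chain2[OF DERIV_sigmoid this]] show ?thesis
      by (simp add: bump_def mult_ac)
  qed
  have c: "isCont (bump k p) t" for t
    using schwartz_continuous(1)[OF bump_schwartz[OF k], where n = 0] by simp
  have top: "LIM t at_top. k * (p - t) :> at_bot" and bot: "LIM t at_bot. k * (p - t) :> at_top"
    using k by (auto simp: filterlim_at_bot filterlim_at_top eventually_at_top_linorder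
        eventually_at_bot_linorder field_simps intro!: exI[of _ "p - _ / k"])
  have s0: "(sigmoid \<longlongrightarrow> 0) at_bot"
    by (rule tendsto_sandwich[OF _ _ tendsto_const exp_at_bot])
       (auto intro!: always_eventually less_imp_le sigmoid_bounds)
  have "((\<lambda>u. 1 - sigmoid (- u)) \<longlongrightarrow> 1 - 0) at_top"
    by (intro tendsto_diff tendsto_const filterlim_compose[OF s0] filterlim_uminus_at_bot_at_top)
  then have s1: "(sigmoid \<longlongrightarrow> 1) at_top" by (simp add: sigmoid_minus)
  have l: "((\<lambda>t. - sigmoid (k * (p - t))) \<longlongrightarrow> - 0) at_top" "((\<lambda>t. - sigmoid (k * (p - t))) \<longlongrightarrow> - 1) at_bot"
    by (intro tendsto_minus filterlim_compose[OF s0 top] filterlim_compose[OF s1 bot])+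
  have "set_integrable lborel (einterval (-\<infinity>) \<infinity>) (bump k p)"
    "(LBINT t=-\<infinity>..\<infinity>. bump k p t) = 0 - (- 1)"
    using D c bump_pos[OF k] l
    by (intro interval_integral_FTC_nonneg[where F = "\<lambda>t. - sigmoid (k * (p - t))"];
        simp add: ereal_tendsto_simps less_imp_le)+
  then show "integrable lborel (bump k p)" "(LINT t|lborel. bump k p t) = 1"
    by (simp_all add: set_integrable_def interval_integral_to_infinity_eq
        interval_lebesgue_integral_def set_lebesgue_integral_def)
qed

text \<open>
  The tail of \<open>f\<close> is controlled through integrability against the bump of width one: away from
  \<open>p\<close>, the narrower bumps are tiny multiples of it.
\<close>

lemma bump_approximate_identity:
  assumes f: "isCont f p" and int: "\<And>k. k > 0 \<Longrightarrow> integrable lborel (\<lambda>t. f t * bump k p t)"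
  shows "(\<lambda>n. LINT t|lborel. f t * bump (real (Suc n)) p t) \<longlonglongrightarrow> f p"
proof (rule LIMSEQ_I)
  fix e :: real assume e: "e > 0"
  define g where "g t = f t - f p" for t
  have gint: "integrable lborel (\<lambda>t. g t * bump k p t)" if "k > 0" for k
    using int[OF that] bump_integral(1)[OF that, of p] unfolding g_def by (simp add: left_diff_distrib)
  have gI: "(LINT t|lborel. g t * bump k p t) = (LINT t|lborel. f t * bump k p t) - f p" if "k > 0" for k
    using int[OF that] bump_integral[OF that, of p] unfolding g_def by (simp add: left_diff_distrib)
  define A where "A = (LINT t|lborel. \<bar>g t\<bar> * bump 1 p t)"
  have gabs: "integrable lborel (\<lambda>t. \<bar>g t\<bar> * bump k p t)" if "k > 0" for k
    using integrable_abs[OF gint[OF that]] that by (simp add: abs_mult abs_bump)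
  obtain d where d: "d > 0" "\<And>t. \<bar>t - p\<bar> < d \<Longrightarrow> \<bar>g t\<bar> \<le> e / 2"
    using f[unfolded continuous_at_eps_delta, rule_format, of "e/2"] e
    unfolding g_def dist_real_def by (metis half_gt_zero less_imp_le)
  \<comment> \<open>at distance at least \<open>d\<close> from \<open>p\<close>, the bump of sharpness \<open>n + 1\<close> is at most \<open>r n\<close> times that of sharpness 1\<close>
  define r where "r n = 4 * (real (Suc n) * exp (- d) ^ n)" for n
  have main: "\<bar>(LINT t|lborel. f t * bump (Suc n) p t) - f p\<bar> \<le> e / 2 + r n * A" for n
  proof -
    let ?k = "real (Suc n)"
    have pw: "\<bar>g t\<bar> * bump ?k p t \<le> e / 2 * bump ?k p t + r n * (\<bar>g t\<bar> * bump 1 p t)" for t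
    proof (cases "\<bar>t - p\<bar> < d")
      case True
      then show ?thesis using d(2)[of t] bump_pos[of ?k p t] bump_pos[of 1 p t]
        by (intro add_increasing2 mult_right_mono) (auto simp: r_def less_imp_le)
    next
      case False
      let ?v = "\<bar>p - t\<bar>"
      have "bump ?k p t \<le> ?k * exp (- \<bar>?k * (p - t)\<bar>)"
        unfolding bump_def by (intro mult_left_mono sigmoid_density_upper) auto
      also have "\<bar>?k * (p - t)\<bar> = n * ?v + ?v"
        using abs_mult[of ?k "p - t"] by (simp add: distrib_right)
      also have "?k * exp (- (n * ?v + ?v)) = ?k * (exp (- (n * ?v)) * exp (- ?v))"
        by (simp flip: exp_add)
      also have "\<dots> \<le> ?k * (exp (- (n * d)) * (4 * bump 1 p t))"
        using False sigmoid_density_lower[of "p - t"]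
        by (intro mult_left_mono mult_mono) (auto simp: bump_def intro!: mult_left_mono)
      also have "\<dots> = r n * bump 1 p t"
        unfolding r_def by (simp add: exp_of_nat_mult[symmetric] mult_ac)
      finally have "\<bar>g t\<bar> * bump ?k p t \<le> \<bar>g t\<bar> * (r n * bump 1 p t)"
        by (intro mult_left_mono) auto
      moreover have "0 \<le> e / 2 * bump ?k p t" using e bump_pos[of ?k p t] by (simp add: less_imp_le)
      ultimately show ?thesis by (simp add: mult_ac)
    qed
    have "\<bar>(LINT t|lborel. f t * bump ?k p t) - f p\<bar> = \<bar>LINT t|lborel. g t * bump ?k p t\<bar>"
      by (simp add: gI)
    also have "\<dots> \<le> (LINT t|lborel. \<bar>g t * bump ?k p t\<bar>)" by (rule integral_abs_bound)
    also have "\<dots> = (LINT t|lborel. \<bar>g t\<bar> * bump ?k p t)"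
      by (simp add: abs_mult abs_bump)
    also have "\<dots> \<le> (LINT t|lborel. e / 2 * bump ?k p t + r n * (\<bar>g t\<bar> * bump 1 p t))"
      by (intro integral_mono pw gabs Bochner_Integration.integrable_add integrable_mult_right bump_integral) auto
    also have "\<dots> = e / 2 + r n * A"
      unfolding A_def using gabs[of 1] bump_integral[of ?k p] by simp
    finally show ?thesis .
  qed
  have "(\<lambda>n. real n * exp (- d) ^ n) \<longlonglongrightarrow> 0" "(\<lambda>n. exp (- d) ^ n) \<longlonglongrightarrow> 0"
    using d(1) by (auto intro!: powser_times_n_limit_0 LIMSEQ_power_zero)
  from tendsto_add[OF this] have "(\<lambda>n. real (Suc n) * exp (- d) ^ n) \<longlonglongrightarrow> 0"
    by (simp add: algebra_simps)
  then have "(\<lambda>n. 4 * (real (Suc n) * exp (- d) ^ n) * A) \<longlonglongrightarrow> 0"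
    using tendsto_mult_right_zero tendsto_mult_left_zero by blast
  then have "(\<lambda>n. r n * A) \<longlonglongrightarrow> 0" unfolding r_def .
  from LIMSEQ_D[OF this, of "e/2"] e obtain N where N: "\<And>n. n \<ge> N \<Longrightarrow> \<bar>r n * A\<bar> < e / 2" by auto
  have "norm ((LINT t|lborel. f t * bump (real (Suc n)) p t) - f p) < e" if "n \<ge> N" for n
    using main[of n] N[OF that] by (simp del: of_nat_Suc)
  then show "\<exists>N. \<forall>n\<ge>N. norm ((LINT t|lborel. f t * bump (real (Suc n)) p t) - f p) < e"
    by blast
qed

section \<open>Signed measures are determined by Schwartz functions\<close>

lemma signed_integral_tendsto:
  assumes \<mu>: "\<mu> \<in> signed_measures"
    and m: "\<And>n. \<phi> n \<in> borel_measurable borel" "\<psi> \<in> borel_measurable borel"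
    and b: "\<And>n t. \<bar>\<phi> n t\<bar> \<le> C" and lim: "\<And>t. (\<lambda>n. \<phi> n t) \<longlonglongrightarrow> \<psi> t"
  shows "(\<lambda>n. signed_integral \<mu> (\<phi> n)) \<longlonglongrightarrow> signed_integral \<mu> \<psi>"
proof -
  have "(\<lambda>n. LINT t|positive_part \<nu>. \<phi> n t) \<longlonglongrightarrow> (LINT t|positive_part \<nu>. \<psi> t)"
    if "\<nu> \<in> signed_measures" for \<nu>
  proof (rule integral_dominated_convergence[where w = "\<lambda>_. C"])
    interpret finite_measure "positive_part \<nu>" by (rule finite_measure_positive_part) fact
    show "integrable (positive_part \<nu>) (\<lambda>_. C)" by simp
  qed (use m b lim in \<open>simp_all cong: measurable_cong_sets\<close>)
  from tendsto_diff[OF this[OF \<mu>] this[OF signed_measures_uminus[OF \<mu>]]]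
  show ?thesis unfolding signed_integral_def .
qed

lemma signed_integral_indicator:
  assumes "\<mu> \<in> signed_measures" "A \<in> sets borel"
  shows "signed_integral \<mu> (indicator A) = \<mu> A"
  using assms by (simp add: signed_integral_def jordan_decomposition[of \<mu> A])

lemma measurable_hats: "(\<lambda>t::real. \<Sum>i\<in>I. c i * max 0 (p i - t)) \<in> borel_measurable borel"
  by measurable

lemma soft_eta_signed_integral_tendsto:
  assumes \<mu>: "\<mu> \<in> signed_measures"
    and I: "finite I" "(\<Sum>i\<in>I. c i) = 0" "(\<Sum>i\<in>I. c i * p i) = 0"
  shows "(\<lambda>n. signed_integral \<mu> (soft_eta (real (Suc n)) I c p))
    \<longlonglongrightarrow> signed_integral \<mu> (\<lambda>t. \<Sum>i\<in>I. c i * max 0 (p i - t))"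
proof -
  have S: "soft_eta (real (Suc n)) I c p \<in> schwartz_space" for n
    using soft_eta_schwartz(1)[OF I] by simp
  obtain C where C: "\<And>t. \<bar>soft_eta 1 I c p t\<bar> \<le> C"
    using schwartz_spaceD(2)[OF S[of 0], of 0 0] by auto
  have B: "\<bar>\<Sum>i\<in>I. c i * max 0 (p i - t)\<bar> \<le> C + (\<Sum>i\<in>I. \<bar>c i\<bar>) * ln 2" for t
    using soft_eta_approx[of 1 I c p t] C[of t] by auto
  show ?thesis
  proof (rule signed_integral_uniform_limit[OF \<mu> _ measurable_hats B])
    show "soft_eta (real (Suc n)) I c p \<in> borel_measurable borel" for n
      by (rule schwartz_continuous(3)[OF S])
    show "\<bar>soft_eta (real (Suc n)) I c p t - (\<Sum>i\<in>I. c i * max 0 (p i - t))\<bar>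
      \<le> (\<Sum>i\<in>I. \<bar>c i\<bar>) * ln 2 * inverse (real (Suc n))" for n t
      using soft_eta_approx[of "real (Suc n)" I c p t] by (simp add: divide_inverse)
    show "(\<lambda>n. (\<Sum>i\<in>I. \<bar>c i\<bar>) * ln 2 * inverse (real (Suc n))) \<longlonglongrightarrow> 0"
      by (rule tendsto_mult_right_zero[OF LIMSEQ_inverse_real_of_nat])
  qed
qed

text \<open>
  Schwartz functions approximate balanced combinations of ramps, these include the trapezoids, and
  trapezoids with ever steeper flanks converge to indicators of compact intervals.
\<close>

lemma signed_measure_eqI:
  assumes \<mu>: "\<mu> \<in> signed_measures" and \<nu>: "\<nu> \<in> signed_measures"
    and eq: "\<And>\<phi>. \<phi> \<in> schwartz_space \<Longrightarrow> signed_integral \<mu> \<phi> = signed_integral \<nu> \<phi>"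
  shows "\<mu> = \<nu>"
proof -
  have hats: "signed_integral \<mu> (\<lambda>t. \<Sum>i\<in>I. c i * max 0 (p i - t)) = signed_integral \<nu> (\<lambda>t. \<Sum>i\<in>I. c i * max 0 (p i - t))"
    if I: "finite I" "(\<Sum>i\<in>I. c i) = 0" "(\<Sum>i\<in>I. c i * p i) = 0" for I :: "nat set" and c p
    using soft_eta_signed_integral_tendsto[OF \<mu> I] soft_eta_signed_integral_tendsto[OF \<nu> I]
      eq[OF soft_eta_schwartz(1)[OF I]] by (simp add: LIMSEQ_unique)
  have ivl: "\<mu> {a..b} = \<nu> {a..b}" if ab: "a \<le> b" for a b
  proof -
    define h where "h n = inverse (real (Suc n))" for n
    have h: "h n > 0" for n by (simp add: h_def)
    have h0: "h \<longlonglongrightarrow> 0" unfolding h_def by (rule LIMSEQ_inverse_real_of_nat)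
    define trap where "trap n t =
      (max 0 (b + h n - t) - max 0 (b - t) - max 0 (a - t) + max 0 (a - h n - t)) / h n" for n t
    \<comment> \<open>four ramps; indexing them by numbers allows \<open>a = b\<close>\<close>
    have "trap n = (\<lambda>t. \<Sum>i\<in>{0,1,2,3::nat}. (if i \<in> {0,3} then 1 / h n else - (1 / h n)) *
        max 0 ([b + h n, b, a, a - h n] ! i - t))" for n
      by (simp add: trap_def fun_eq_iff diff_divide_distrib add_divide_distrib numeral_2_eq_2 numeral_3_eq_3)
    then have same: "signed_integral \<mu> (trap n) = signed_integral \<nu> (trap n)" for n
      using h[of n] by (simp only:) (intro hats; simp add: field_simps numeral_2_eq_2 numeral_3_eq_3)
    have lim: "(\<lambda>n. signed_integral \<kappa> (trap n)) \<longlonglongrightarrow> signed_integral \<kappa> (indicator {a..b})"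
      if "\<kappa> \<in> signed_measures" for \<kappa>
    proof (rule signed_integral_tendsto[OF that, of _ _ 1])
      show "\<bar>trap n t\<bar> \<le> 1" for n t
        using h[of n] ab unfolding trap_def by (auto simp: divide_simps max_def)
      show "(\<lambda>n. trap n t) \<longlonglongrightarrow> indicator {a..b} t" for t
      proof (cases "t \<in> {a..b}")
        case True
        then have "trap n t = 1" for n using h[of n] unfolding trap_def by (auto simp: max_def)
        then show ?thesis using True by simp
      next
        case False
        then have "\<forall>\<^sub>F n in sequentially. h n < (if t < a then a - t else t - b)"
          using ab by (intro order_tendstoD(2)[OF h0]) auto
        then have "\<forall>\<^sub>F n in sequentially. trap n t = 0"
        proof (rule eventually_mono)
          fix n assume "h n < (if t < a then a - t else t - b)"
          then show "trap n t = 0" using False ab h[of n] by (auto simp: trap_def max_def split: if_splits)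
        qed
        then show ?thesis using False by (simp add: tendsto_eventually)
      qed
    qed (auto simp: trap_def[abs_def])
    have "signed_integral \<mu> (indicator {a..b}) = signed_integral \<nu> (indicator {a..b})"
      by (rule LIMSEQ_unique[OF lim[OF \<mu>] lim[OF \<nu>, folded same]])
    then show ?thesis by (simp add: signed_integral_indicator \<mu> \<nu>)
  qed
  have UNIV: "\<mu> UNIV = \<nu> UNIV"
  proof -
    have "(\<lambda>n. \<kappa> {- real n..real n}) \<longlonglongrightarrow> \<kappa> UNIV" if \<kappa>: "\<kappa> \<in> signed_measures" for \<kappa>
    proof -
      have "(\<lambda>n. signed_integral \<kappa> (indicator {- real n..real n})) \<longlonglongrightarrow> signed_integral \<kappa> (indicator UNIV)"
      proof (rule signed_integral_tendsto[OF \<kappa>, of _ _ 1])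
        fix t :: real
        obtain N :: nat where "\<bar>t\<bar> \<le> real N" using real_arch_simple by blast
        then have "indicator {- real n..real n} t = (indicator UNIV t :: real)" if "n \<ge> N" for n
          using that by (auto simp: indicator_def)
        then show "(\<lambda>n. indicator {- real n..real n} t) \<longlonglongrightarrow> (indicator UNIV t :: real)"
          by (intro tendsto_eventually eventually_sequentiallyI)
      qed (auto simp: indicator_def)
      then show ?thesis using \<kappa> by (simp add: signed_integral_indicator del: indicator_UNIV)
    qed
    from this[OF \<mu>] this[OF \<nu>]
    have "(\<lambda>n. \<mu> {- real n..real n}) \<longlonglongrightarrow> \<mu> UNIV" "(\<lambda>n. \<mu> {- real n..real n}) \<longlonglongrightarrow> \<nu> UNIV"
      by (simp_all add: ivl)
    then show ?thesis by (rule LIMSEQ_unique)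
  qed
  have "\<mu> A = \<nu> A" if "A \<in> sets borel" for A
    using that
  proof (induction A rule: borel_set_induct)
    case empty
    then show ?case using signed_measuresD(1)[OF \<mu>] signed_measuresD(1)[OF \<nu>] by simp
  next
    case (interval a b)
    then show ?case by (rule ivl)
  next
    case (compl A)
    then show ?case
      using signed_measure_Diff[OF \<mu>, of UNIV A] signed_measure_Diff[OF \<nu>, of UNIV A] UNIV
      by (simp add: Compl_eq_Diff_UNIV)
  next
    case (union f)
    then have "range f \<subseteq> sets borel" by auto
    from signed_measuresD(2)[OF \<mu> this \<open>disjoint_family f\<close>] signed_measuresD(2)[OF \<nu> this \<open>disjoint_family f\<close>]
    show ?case unfolding union.IH by (rule sums_unique2)
  qed
  then show ?thesis
    using signed_measuresD(3)[OF \<mu>] signed_measuresD(3)[OF \<nu>] by (metis ext)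
qed

lemma inj_on_measure_distr: "inj_on measure_distr signed_measures"
proof (rule inj_onI)
  fix \<mu> \<nu> assume *: "\<mu> \<in> signed_measures" "\<nu> \<in> signed_measures" "measure_distr \<mu> = measure_distr \<nu>"
  have "signed_integral \<mu> \<phi> = signed_integral \<nu> \<phi>" if "\<phi> \<in> schwartz_space" for \<phi>
    using fun_cong[OF *(3), of \<phi>] that by (simp add: measure_distr_def)
  with *(1,2) show "\<mu> = \<nu>" by (rule signed_measure_eqI)
qed

section \<open>Pairing a weak second derivative with piecewise linear functions\<close>

definition weak_second_deriv :: "(real \<Rightarrow> real) \<Rightarrow> (real set \<Rightarrow> real) \<Rightarrow> bool" where
  "weak_second_deriv f \<mu> \<longleftrightarrow> continuous_on UNIV f \<and> \<mu> \<in> signed_measures \<and>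
     (\<forall>\<phi>\<in>schwartz_space. integrable lborel (\<lambda>t. f t * \<phi> t) \<and>
        (LINT t|lborel. f t * deriv (deriv \<phi>) t) = signed_integral \<mu> \<phi>)"

text \<open>
  Testing against the smoothed function \<^const>\<open>soft_eta\<close> moves the two derivatives from \<open>f\<close> to the
  test function, where they become bumps that concentrate at the points \<open>p i\<close>.
\<close>

lemma weak_second_deriv_hats:
  assumes f: "weak_second_deriv f \<mu>"
    and I: "finite I" "(\<Sum>i\<in>I. c i) = 0" "(\<Sum>i\<in>I. c i * p i) = 0"
  shows "signed_integral \<mu> (\<lambda>t. \<Sum>i\<in>I. c i * max 0 (p i - t)) = (\<Sum>i\<in>I. c i * f (p i))"
proof (rule LIMSEQ_unique)
  have f': "continuous_on UNIV f" "\<mu> \<in> signed_measures"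
    "\<And>\<phi>. \<phi> \<in> schwartz_space \<Longrightarrow> integrable lborel (\<lambda>t. f t * \<phi> t)"
    "\<And>\<phi>. \<phi> \<in> schwartz_space \<Longrightarrow> (LINT t|lborel. f t * deriv (deriv \<phi>) t) = signed_integral \<mu> \<phi>"
    using f unfolding weak_second_deriv_def by auto
  have fb: "integrable lborel (\<lambda>t. f t * bump k q t)" if "k > 0" for k q
    using f'(3)[OF bump_schwartz[OF that]] .
  have "signed_integral \<mu> (soft_eta (real (Suc n)) I c p)
    = (\<Sum>i\<in>I. c i * (LINT t|lborel. f t * bump (real (Suc n)) (p i) t))" for n
  proof -
    have "signed_integral \<mu> (soft_eta (real (Suc n)) I c p)
      = (LINT t|lborel. f t * (\<Sum>i\<in>I. c i * bump (real (Suc n)) (p i) t))"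
      using f'(4)[OF soft_eta_schwartz(1)[OF I], of "real (Suc n)"]
        soft_eta_schwartz(2)[OF I, of "real (Suc n)"] by (simp del: of_nat_Suc)
    also have "\<dots> = (LINT t|lborel. (\<Sum>i\<in>I. c i * (f t * bump (real (Suc n)) (p i) t)))"
      by (simp add: sum_distrib_left mult_ac)
    also have "\<dots> = (\<Sum>i\<in>I. c i * (LINT t|lborel. f t * bump (real (Suc n)) (p i) t))"
      using fb by (subst Bochner_Integration.integral_sum) auto
    finally show ?thesis .
  qed
  moreover have "(\<lambda>n. \<Sum>i\<in>I. c i * (LINT t|lborel. f t * bump (real (Suc n)) (p i) t)) \<longlonglongrightarrow> (\<Sum>i\<in>I. c i * f (p i))"
    using f'(1) fb by (intro tendsto_sum tendsto_mult tendsto_const bump_approximate_identity)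
      (auto simp: continuous_on_eq_continuous_at)
  ultimately show "(\<lambda>n. signed_integral \<mu> (soft_eta (real (Suc n)) I c p)) \<longlonglongrightarrow> (\<Sum>i\<in>I. c i * f (p i))"
    by simp
  show "(\<lambda>n. signed_integral \<mu> (soft_eta (real (Suc n)) I c p))
    \<longlonglongrightarrow> signed_integral \<mu> (\<lambda>t. \<Sum>i\<in>I. c i * max 0 (p i - t))"
    by (rule soft_eta_signed_integral_tendsto[OF f'(2) I])
qed

text \<open>
  The hat with corners \<open>p\<close>, \<open>q\<close> and \<open>t\<close> (in whatever order) has the same pairing with both
  functions, which expresses the value at \<open>t\<close> through the values at \<open>p\<close> and \<open>q\<close>.
\<close>

lemma weak_second_deriv_unique:
  assumes f: "weak_second_deriv f \<mu>" "weak_second_deriv g \<mu>" and "p \<noteq> q" "f p = g p" "f q = g q"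
  shows "f = g"
proof
  fix t
  \<comment> \<open>up to scaling, the only weights on \<open>p\<close>, \<open>q\<close>, \<open>t\<close> that annihilate affine functions\<close>
  define c where "c i = [t - q, p - t, q - p] ! i" for i
  define s where "s i = [p, q, t] ! i" for i
  have I: "finite {0,1,2::nat}" "(\<Sum>i\<in>{0,1,2}. c i) = 0" "(\<Sum>i\<in>{0,1,2}. c i * s i) = 0"
    by (simp_all add: c_def s_def numeral_2_eq_2 algebra_simps)
  have "(\<Sum>i\<in>{0,1,2}. c i * f (s i)) = (\<Sum>i\<in>{0,1,2}. c i * g (s i))"
    using weak_second_deriv_hats[OF f(1) I] weak_second_deriv_hats[OF f(2) I] by simp
  then show "f t = g t" using assms(3-) by (simp add: c_def s_def numeral_2_eq_2)
qed

section \<open>Linear splines as tempered distributions\<close>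

lemma integrable_inverse_one_plus_square: "integrable lborel (\<lambda>t::real. 1 / (1 + t\<^sup>2))"
proof -
  have "set_integrable lborel (einterval (-\<infinity>) \<infinity>) (\<lambda>t::real. inverse (1 + t\<^sup>2))"
  proof (rule interval_integral_FTC_nonneg(1)[where F = arctan])
    show "((arctan \<circ> real_of_ereal) \<longlongrightarrow> - (pi / 2)) (at_right (-\<infinity>))"
      "((arctan \<circ> real_of_ereal) \<longlongrightarrow> pi / 2) (at_left \<infinity>)"
      by (simp_all add: ereal_tendsto_simps tendsto_arctan_at_bot tendsto_arctan_at_top)
    show "(arctan has_real_derivative inverse (1 + t\<^sup>2)) (at t)" for t by (rule DERIV_arctan)
    show "isCont (\<lambda>t::real. inverse (1 + t\<^sup>2)) t" for t
      by (intro continuous_intros) (simp add: add_nonneg_eq_0_iff)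
  qed auto
  then show ?thesis by (simp add: set_integrable_def inverse_eq_divide)
qed

lemma schwartz_add:
  assumes \<phi>: "\<phi> \<in> schwartz_space" and \<psi>: "\<psi> \<in> schwartz_space"
  shows "(\<lambda>t. \<phi> t + \<psi> t) \<in> schwartz_space"
proof -
  have D: "(deriv ^^ n) (\<lambda>t. \<phi> t + \<psi> t) = (\<lambda>t. (deriv ^^ n) \<phi> t + (deriv ^^ n) \<psi> t)" for n
  proof (induction n)
    case (Suc n)
    have "deriv (\<lambda>t. (deriv ^^ n) \<phi> t + (deriv ^^ n) \<psi> t) t = (deriv ^^ Suc n) \<phi> t + (deriv ^^ Suc n) \<psi> t" for t
      by (intro DERIV_imp_deriv DERIV_add schwartz_spaceD(1) \<phi> \<psi>)
    then show ?case by (simp add: Suc.IH fun_eq_iff)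
  qed simp
  have "bounded (range (\<lambda>t. t ^ k * ((deriv ^^ n) \<phi> t + (deriv ^^ n) \<psi> t)))" for k n
    using \<phi> \<psi> unfolding schwartz_space_def distrib_left by (intro bounded_plus_comp) auto
  with \<phi> \<psi> show ?thesis unfolding schwartz_space_def by (auto simp: D intro: differentiable_on_add)
qed

lemma schwartz_cmult:
  assumes \<phi>: "\<phi> \<in> schwartz_space"
  shows "(\<lambda>t. a * \<phi> t) \<in> schwartz_space"
proof -
  have D: "(deriv ^^ n) (\<lambda>t. a * \<phi> t) = (\<lambda>t. a * (deriv ^^ n) \<phi> t)" for n
  proof (induction n)
    case (Suc n)
    have "deriv (\<lambda>t. a * (deriv ^^ n) \<phi> t) t = a * (deriv ^^ Suc n) \<phi> t" for t
      by (intro DERIV_imp_deriv DERIV_cmult schwartz_spaceD(1) \<phi>)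
    then show ?case by (simp add: Suc.IH fun_eq_iff)
  qed simp
  have "\<exists>B. \<forall>t. \<bar>t ^ k * (a * (deriv ^^ n) \<phi> t)\<bar> \<le> B" for k n
  proof -
    obtain C where "\<And>t. \<bar>t ^ k * (deriv ^^ n) \<phi> t\<bar> \<le> C" using schwartz_spaceD(2)[OF \<phi>] by blast
    then have "\<bar>a\<bar> * \<bar>t ^ k * (deriv ^^ n) \<phi> t\<bar> \<le> \<bar>a\<bar> * C" for t by (intro mult_left_mono) auto
    then show ?thesis by (intro exI[of _ "\<bar>a\<bar> * C"]) (simp add: abs_mult mult.left_commute)
  qed
  then have "bounded (range (\<lambda>t. t ^ k * (a * (deriv ^^ n) \<phi> t)))" for k n
    unfolding bounded_iff by auto
  with \<phi> show ?thesis unfolding schwartz_space_def by (auto simp: D intro!: differentiable_on_mult)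
qed

lemma schwartz_seminorm_upper:
  assumes "\<phi> \<in> schwartz_space"
  shows "\<bar>t ^ k * (deriv ^^ n) \<phi> t\<bar> \<le> schwartz_seminorm k n \<phi>"
proof -
  obtain C where "\<And>t. \<bar>t ^ k * (deriv ^^ n) \<phi> t\<bar> \<le> C" using schwartz_spaceD(2)[OF assms] by blast
  then show ?thesis unfolding schwartz_seminorm_def by (intro cSUP_upper bdd_aboveI2) auto
qed

lemma schwartz_seminorm_nonneg: "\<phi> \<in> schwartz_space \<Longrightarrow> 0 \<le> schwartz_seminorm k n \<phi>"
  using schwartz_seminorm_upper[of \<phi> 0 k n] by (meson abs_ge_zero order_trans)

text \<open>
  Four seminorms suffice because \<open>(1 + \<bar>t\<bar>) * (1 + t\<^sup>2) = 1 + \<bar>t\<bar> + \<bar>t\<bar>\<^sup>2 + \<bar>t\<bar> ^ 3\<close>; dividing by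
  \<open>1 + t\<^sup>2\<close> leaves room for a factor of linear growth and an integrable majorant.
\<close>

lemma schwartz_decay:
  assumes \<phi>: "\<phi> \<in> schwartz_space"
  shows "(1 + \<bar>t\<bar>) * \<bar>(deriv ^^ n) \<phi> t\<bar> \<le> (\<Sum>k\<le>3. schwartz_seminorm k n \<phi>) * (1 / (1 + t\<^sup>2))"
proof -
  let ?a = "\<bar>(deriv ^^ n) \<phi> t\<bar>"
  have "\<bar>t\<bar> ^ k * ?a \<le> schwartz_seminorm k n \<phi>" for k
    using schwartz_seminorm_upper[OF \<phi>, of t k n] by (simp add: abs_mult power_abs)
  then have "(\<Sum>k\<le>3. \<bar>t\<bar> ^ k * ?a) \<le> (\<Sum>k\<le>3. schwartz_seminorm k n \<phi>)" by (intro sum_mono) auto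
  moreover have "(\<Sum>k\<le>3. \<bar>t\<bar> ^ k * ?a) = (1 + \<bar>t\<bar>) * ?a * (1 + t\<^sup>2)"
    by (simp add: numeral_3_eq_3 power2_eq_square algebra_simps flip: abs_mult)
  moreover have "1 + t\<^sup>2 > 0" by (simp add: add_pos_nonneg)
  ultimately show ?thesis by (simp add: field_simps)
qed

lemma schwartz_integrable_linear_growth:
  assumes \<phi>: "\<phi> \<in> schwartz_space" and m: "f \<in> borel_measurable borel"
    and b: "\<And>t. \<bar>f t\<bar> \<le> C * (1 + \<bar>t\<bar>)"
  shows "integrable lborel (\<lambda>t. f t * (deriv ^^ n) \<phi> t)"
    and "\<bar>LINT t|lborel. f t * (deriv ^^ n) \<phi> t\<bar>
      \<le> C * (\<Sum>k\<le>3. schwartz_seminorm k n \<phi>) * (LINT t|lborel. 1 / (1 + t\<^sup>2))"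
proof -
  let ?S = "\<Sum>k\<le>3. schwartz_seminorm k n \<phi>"
  have C: "C \<ge> 0" using b[of 0] by simp
  have bound: "\<bar>f t * (deriv ^^ n) \<phi> t\<bar> \<le> C * ?S * (1 / (1 + t\<^sup>2))" for t
  proof -
    have "\<bar>f t * (deriv ^^ n) \<phi> t\<bar> \<le> C * (1 + \<bar>t\<bar>) * \<bar>(deriv ^^ n) \<phi> t\<bar>"
      unfolding abs_mult by (intro mult_right_mono b) auto
    also have "\<dots> = C * ((1 + \<bar>t\<bar>) * \<bar>(deriv ^^ n) \<phi> t\<bar>)" by simp
    also have "\<dots> \<le> C * (?S * (1 / (1 + t\<^sup>2)))"
      by (intro mult_left_mono schwartz_decay[OF \<phi>] C)
    finally show ?thesis by (simp only: mult.assoc)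
  qed
  have "continuous_on UNIV ((deriv ^^ n) \<phi>)"
    by (intro continuous_at_imp_continuous_on ballI schwartz_continuous(1)[OF \<phi>])
  then have m': "(deriv ^^ n) \<phi> \<in> borel_measurable borel" by (rule borel_measurable_continuous_onI)
  have J: "integrable lborel (\<lambda>t. C * ?S * (1 / (1 + t\<^sup>2)))"
    by (intro integrable_mult_right integrable_inverse_one_plus_square)
  show I: "integrable lborel (\<lambda>t. f t * (deriv ^^ n) \<phi> t)"
  proof (rule Bochner_Integration.integrable_bound[OF J])
    show "AE t in lborel. norm (f t * (deriv ^^ n) \<phi> t) \<le> norm (C * ?S * (1 / (1 + t\<^sup>2)))"
      unfolding real_norm_def by (intro AE_I2 order_trans[OF bound abs_ge_self])
  qed (use m m' in measurable)
  have "\<bar>LINT t|lborel. f t * (deriv ^^ n) \<phi> t\<bar> \<le> (LINT t|lborel. \<bar>f t * (deriv ^^ n) \<phi> t\<bar>)"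
    by (rule integral_abs_bound)
  also have "\<dots> \<le> (LINT t|lborel. C * ?S * (1 / (1 + t\<^sup>2)))"
    using bound I J by (intro integral_mono) auto
  finally show "\<bar>LINT t|lborel. f t * (deriv ^^ n) \<phi> t\<bar> \<le> C * ?S * (LINT t|lborel. 1 / (1 + t\<^sup>2))"
    by (simp only: integral_mult_right_zero)
qed

lemma schwartz_tendsto_0:
  assumes \<phi>: "\<phi> \<in> schwartz_space"
  shows "((\<lambda>t. t ^ k * (deriv ^^ n) \<phi> t) \<longlongrightarrow> 0) at_infinity"
proof -
  obtain C where C: "\<And>t. \<bar>t ^ Suc k * (deriv ^^ n) \<phi> t\<bar> \<le> C" using schwartz_spaceD(2)[OF \<phi>] by blast
  show ?thesis
  proof (rule Lim_null_comparison)
    have "\<bar>t ^ k * (deriv ^^ n) \<phi> t\<bar> \<le> C / norm t" if "norm t > 0" for t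
    proof -
      have "\<bar>t\<bar> * \<bar>t ^ k * (deriv ^^ n) \<phi> t\<bar> \<le> C"
        using C[of t] by (simp add: abs_mult mult.assoc)
      then show ?thesis using that by (simp add: field_simps)
    qed
    moreover have "\<forall>\<^sub>F t in at_infinity. norm (t::real) > 0"
      using filterlim_norm_at_top[where 'a = real] unfolding filterlim_at_top_dense by blast
    ultimately show "\<forall>\<^sub>F t in at_infinity. norm (t ^ k * (deriv ^^ n) \<phi> t) \<le> C / norm t"
      by (auto elim: eventually_mono)
    show "((\<lambda>t::real. C / norm t) \<longlongrightarrow> 0) at_infinity"
      by (intro tendsto_divide_0[OF tendsto_const] filterlim_at_top_imp_at_infinity filterlim_norm_at_top)
  qed
qed

lemma schwartz_second_antiderivative:
  assumes \<phi>: "\<phi> \<in> schwartz_space"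
  shows "((\<lambda>t. (\<alpha> + \<beta> * t) * deriv \<phi> t - \<beta> * \<phi> t) has_field_derivative (\<alpha> + \<beta> * t) * deriv (deriv \<phi>) t) (at t)"
    and "((\<lambda>t. (\<alpha> + \<beta> * t) * deriv \<phi> t - \<beta> * \<phi> t) \<longlongrightarrow> 0) at_infinity"
proof -
  have D: "(\<phi> has_field_derivative deriv \<phi> t) (at t)" "(deriv \<phi> has_field_derivative deriv (deriv \<phi>) t) (at t)"
    using schwartz_spaceD(1)[OF \<phi>, of 0 t] schwartz_spaceD(1)[OF \<phi>, of 1 t] by simp_all
  show "((\<lambda>t. (\<alpha> + \<beta> * t) * deriv \<phi> t - \<beta> * \<phi> t) has_field_derivative (\<alpha> + \<beta> * t) * deriv (deriv \<phi>) t) (at t)"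
    using D by (auto intro!: derivative_eq_intros)
  have "((\<lambda>t. \<alpha> * (t ^ 0 * (deriv ^^ 1) \<phi> t) + \<beta> * (t ^ 1 * (deriv ^^ 1) \<phi> t) - \<beta> * (t ^ 0 * (deriv ^^ 0) \<phi> t))
      \<longlongrightarrow> \<alpha> * 0 + \<beta> * 0 - \<beta> * 0) at_infinity"
    by (intro tendsto_intros schwartz_tendsto_0[OF \<phi>])
  then show "((\<lambda>t. (\<alpha> + \<beta> * t) * deriv \<phi> t - \<beta> * \<phi> t) \<longlongrightarrow> 0) at_infinity"
    by (simp add: algebra_simps)
qed

lemma abs_affine_le: "\<bar>\<alpha> + \<beta> * t\<bar> \<le> (\<bar>\<alpha>\<bar> + \<bar>\<beta>\<bar>) * (1 + \<bar>t\<bar>)" for t :: real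
proof -
  have "\<bar>\<alpha> + \<beta> * t\<bar> \<le> \<bar>\<alpha>\<bar> + \<bar>\<beta>\<bar> * \<bar>t\<bar>" by (metis abs_mult abs_triangle_ineq)
  also have "\<dots> \<le> (\<bar>\<alpha>\<bar> + \<bar>\<beta>\<bar>) * (1 + \<bar>t\<bar>)" by (simp add: algebra_simps)
  finally show ?thesis .
qed

lemma abs_ramp_le: "\<bar>max 0 (t - s)\<bar> \<le> (1 + \<bar>s\<bar>) * (1 + \<bar>t\<bar>)" for s t :: real
proof -
  have "\<bar>max 0 (t - s)\<bar> \<le> 1 + \<bar>s\<bar> + \<bar>t\<bar>" by auto
  also have "\<dots> \<le> (1 + \<bar>s\<bar>) * (1 + \<bar>t\<bar>)" by (simp add: algebra_simps)
  finally show ?thesis .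
qed

lemma integral_affine_second_deriv:
  assumes \<phi>: "\<phi> \<in> schwartz_space"
  shows "integrable lborel (\<lambda>t. (\<alpha> + \<beta> * t) * deriv (deriv \<phi>) t)"
    and "(LINT t|lborel. (\<alpha> + \<beta> * t) * deriv (deriv \<phi>) t) = 0"
proof -
  let ?F = "\<lambda>t. (\<alpha> + \<beta> * t) * deriv \<phi> t - \<beta> * \<phi> t"
  show int: "integrable lborel (\<lambda>t. (\<alpha> + \<beta> * t) * deriv (deriv \<phi>) t)"
    using schwartz_integrable_linear_growth(1)[OF \<phi> _ abs_affine_le, of \<alpha> \<beta> 2] by (simp add: numeral_2_eq_2)
  have c: "isCont (deriv (deriv \<phi>)) t" for t
    using schwartz_continuous(1)[OF \<phi>, where n = 2] by (simp add: numeral_2_eq_2)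
  have "(LBINT t=-\<infinity>..\<infinity>. (\<alpha> + \<beta> * t) * deriv (deriv \<phi>) t) = 0 - 0"
  proof (rule interval_integral_FTC_integrable[where F = ?F])
    show "(?F has_vector_derivative (\<alpha> + \<beta> * t) * deriv (deriv \<phi>) t) (at t)" for t
      using schwartz_second_antiderivative(1)[OF \<phi>] has_real_derivative_iff_has_vector_derivative by blast
    show "isCont (\<lambda>t. (\<alpha> + \<beta> * t) * deriv (deriv \<phi>) t) t" for t
      by (intro continuous_intros c)
    show "((?F \<circ> real_of_ereal) \<longlongrightarrow> 0) (at_right (-\<infinity>))" "((?F \<circ> real_of_ereal) \<longlongrightarrow> 0) (at_left \<infinity>)"
      using schwartz_second_antiderivative(2)[OF \<phi>, of \<alpha> \<beta>]
      by (simp_all add: ereal_tendsto_simps tendsto_mono[OF at_bot_le_at_infinity] tendsto_mono[OF at_top_le_at_infinity])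
  qed (use int in \<open>simp_all add: set_integrable_def\<close>)
  then show "(LINT t|lborel. (\<alpha> + \<beta> * t) * deriv (deriv \<phi>) t) = 0"
    by (simp add: interval_lebesgue_integral_def set_lebesgue_integral_def)
qed

text \<open>
  Integration by parts on \<open>[s, \<infinity>)\<close>, in the form that \<open>(t - s) * \<phi>' t - \<phi> t\<close> is an antiderivative
  of the integrand.
\<close>

lemma integral_ramp_second_deriv:
  assumes \<phi>: "\<phi> \<in> schwartz_space"
  shows "integrable lborel (\<lambda>t. max 0 (t - s) * deriv (deriv \<phi>) t)"
    and "(LINT t|lborel. max 0 (t - s) * deriv (deriv \<phi>) t) = \<phi> s"
proof -
  let ?F = "\<lambda>t. (- s + 1 * t) * deriv \<phi> t - 1 * \<phi> t"
  show "integrable lborel (\<lambda>t. max 0 (t - s) * deriv (deriv \<phi>) t)"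
    using schwartz_integrable_linear_growth(1)[OF \<phi> _ abs_ramp_le, of s 2] by (simp add: numeral_2_eq_2)
  have c: "isCont (deriv (deriv \<phi>)) t" for t
    using schwartz_continuous(1)[OF \<phi>, where n = 2] by (simp add: numeral_2_eq_2)
  have eq: "indicator {s<..} t * ((- s + 1 * t) * deriv (deriv \<phi>) t) = max 0 (t - s) * deriv (deriv \<phi>) t" for t
    by (auto simp: indicator_def max_def)
  have "(LBINT t=ereal s..\<infinity>. (- s + 1 * t) * deriv (deriv \<phi>) t) = 0 - ?F s"
  proof (rule interval_integral_FTC_integrable[where F = ?F])
    show "(?F has_vector_derivative (- s + 1 * t) * deriv (deriv \<phi>) t) (at t)" for t
      using schwartz_second_antiderivative(1)[OF \<phi>] has_real_derivative_iff_has_vector_derivative by blast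
    show "isCont (\<lambda>t. (- s + 1 * t) * deriv (deriv \<phi>) t) t" for t
      by (intro continuous_intros c)
    have "isCont ?F s" by (rule DERIV_isCont[OF schwartz_second_antiderivative(1)[OF \<phi>]])
    then have "(?F \<longlongrightarrow> ?F s) (at_right s)"
      unfolding isCont_def by (rule tendsto_mono[OF at_le[OF subset_UNIV]])
    then show "((?F \<circ> real_of_ereal) \<longlongrightarrow> ?F s) (at_right (ereal s))"
      by (simp only: ereal_tendsto_simps)
    show "((?F \<circ> real_of_ereal) \<longlongrightarrow> 0) (at_left \<infinity>)"
      using schwartz_second_antiderivative(2)[OF \<phi>, of "-s" 1]
      by (simp only: ereal_tendsto_simps tendsto_mono[OF at_top_le_at_infinity])
    show "set_integrable lborel (einterval (ereal s) \<infinity>) (\<lambda>t. (- s + 1 * t) * deriv (deriv \<phi>) t)"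
      unfolding set_integrable_def einterval_eq
      by (intro integrable_mult_indicator integral_affine_second_deriv(1)[OF \<phi>]) simp
  qed simp
  then show "(LINT t|lborel. max 0 (t - s) * deriv (deriv \<phi>) t) = \<phi> s"
    unfolding interval_integral_to_infinity_eq set_lebesgue_integral_def real_scaleR_def eq by simp
qed

definition spline :: "real \<Rightarrow> real \<Rightarrow> 'i set \<Rightarrow> ('i \<Rightarrow> real) \<Rightarrow> ('i \<Rightarrow> real) \<Rightarrow> real \<Rightarrow> real" where
  "spline \<alpha> \<beta> I b s t = \<alpha> + \<beta> * t + (\<Sum>i\<in>I. b i * max 0 (t - s i))"

lemma spline_linear_growth: "\<exists>C. \<forall>t. \<bar>spline \<alpha> \<beta> I b s t\<bar> \<le> C * (1 + \<bar>t\<bar>)"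
proof (intro exI allI)
  fix t
  have "\<bar>\<Sum>i\<in>I. b i * max 0 (t - s i)\<bar> \<le> (\<Sum>i\<in>I. \<bar>b i\<bar> * ((1 + \<bar>s i\<bar>) * (1 + \<bar>t\<bar>)))"
    using abs_ramp_le by (intro order_trans[OF sum_abs] sum_mono) (simp add: abs_mult mult_left_mono)
  also have "\<dots> = (\<Sum>i\<in>I. \<bar>b i\<bar> * (1 + \<bar>s i\<bar>)) * (1 + \<bar>t\<bar>)"
    by (simp add: sum_distrib_right mult.assoc)
  finally show "\<bar>spline \<alpha> \<beta> I b s t\<bar> \<le> (\<bar>\<alpha>\<bar> + \<bar>\<beta>\<bar> + (\<Sum>i\<in>I. \<bar>b i\<bar> * (1 + \<bar>s i\<bar>))) * (1 + \<bar>t\<bar>)"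
    using abs_affine_le[of \<alpha> \<beta> t] abs_triangle_ineq[of "\<alpha> + \<beta> * t" "\<Sum>i\<in>I. b i * max 0 (t - s i)"]
    unfolding spline_def distrib_right by linarith
qed

lemma continuous_on_spline: "continuous_on UNIV (spline \<alpha> \<beta> I b s)"
  unfolding spline_def[abs_def] by (intro continuous_intros)

lemma weak_second_deriv_spline:
  assumes I: "finite I"
  shows "weak_second_deriv (spline \<alpha> \<beta> I b s) (dirac_sum I b s)"
  unfolding weak_second_deriv_def
proof (intro conjI ballI continuous_on_spline dirac_sum_signed_measures)
  fix \<phi> assume \<phi>: "\<phi> \<in> schwartz_space"
  obtain C where C: "\<And>t. \<bar>spline \<alpha> \<beta> I b s t\<bar> \<le> C * (1 + \<bar>t\<bar>)" using spline_linear_growth by blast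
  show "integrable lborel (\<lambda>t. spline \<alpha> \<beta> I b s t * \<phi> t)"
    using schwartz_integrable_linear_growth(1)[OF \<phi> borel_measurable_continuous_onI[OF continuous_on_spline] C, of 0]
    by simp
  have "(LINT t|lborel. spline \<alpha> \<beta> I b s t * deriv (deriv \<phi>) t)
    = (LINT t|lborel. (\<alpha> + \<beta> * t) * deriv (deriv \<phi>) t + (\<Sum>i\<in>I. b i * (max 0 (t - s i) * deriv (deriv \<phi>) t)))"
    by (simp add: spline_def distrib_right sum_distrib_right mult.assoc)
  also have "\<dots> = (\<Sum>i\<in>I. b i * \<phi> (s i))"
    using integral_affine_second_deriv[OF \<phi>] integral_ramp_second_deriv[OF \<phi>]
    by (subst Bochner_Integration.integral_add) (auto simp: Bochner_Integration.integral_sum)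
  finally show "(LINT t|lborel. spline \<alpha> \<beta> I b s t * deriv (deriv \<phi>) t) = signed_integral (dirac_sum I b s) \<phi>"
    by (simp add: signed_integral_dirac_sum[OF I schwartz_continuous(3)[OF \<phi>]])
qed

definition regular_distr :: "(real \<Rightarrow> real) \<Rightarrow> (real \<Rightarrow> real) \<Rightarrow> real" where
  "regular_distr f = restrict (\<lambda>\<phi>. LINT t|lborel. f t * \<phi> t) schwartz_space"

lemma norm_M_D2:
  assumes "distr_D2 T = measure_distr \<mu>" "\<mu> \<in> signed_measures"
  shows "norm_M (distr_D2 T) = total_variation \<mu>"
  unfolding norm_M_def assms(1) by (simp add: the_inv_into_f_f[OF inj_on_measure_distr assms(2)])

text \<open>
  This reduces statements about elements of \<^const>\<open>BV2\<close> to statements about their continuous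
  representative and the measure that is its second derivative.
\<close>

lemma BV2_E:
  assumes T: "T \<in> BV2" and f: "is_continuous_function T f"
  obtains \<mu> where "weak_second_deriv f \<mu>" "norm_M (distr_D2 T) = total_variation \<mu>" "T = regular_distr f"
proof -
  obtain \<mu> where \<mu>: "\<mu> \<in> signed_measures" "distr_D2 T = measure_distr \<mu>"
    using T unfolding BV2_def bounded_measures_def by auto
  have Tf: "T \<phi> = (LINT t|lborel. f t * \<phi> t)" if "\<phi> \<in> schwartz_space" for \<phi>
    using f that unfolding is_continuous_function_def by auto
  have "(LINT t|lborel. f t * deriv (deriv \<phi>) t) = signed_integral \<mu> \<phi>" if "\<phi> \<in> schwartz_space" for \<phi>
    using fun_cong[OF \<mu>(2), of \<phi>] that Tf[OF schwartz_deriv_deriv[OF that]]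
    by (simp add: distr_D2_def measure_distr_def)
  then have "weak_second_deriv f \<mu>"
    using f \<mu>(1) unfolding weak_second_deriv_def is_continuous_function_def by auto
  moreover have "T = regular_distr f"
    unfolding regular_distr_def
  proof (rule extensionalityI[of T schwartz_space])
    show "T \<in> extensional schwartz_space" using T unfolding BV2_def tempered_distributions_def by auto
  qed (auto simp: Tf)
  ultimately show ?thesis using that norm_M_D2[OF \<mu>(2,1)] by blast
qed

lemma regular_distr_BV2:
  assumes f: "weak_second_deriv f \<mu>" and growth: "\<And>t. \<bar>f t\<bar> \<le> C * (1 + \<bar>t\<bar>)"
  shows "regular_distr f \<in> BV2" "is_continuous_function (regular_distr f) f"
    "norm_M (distr_D2 (regular_distr f)) = total_variation \<mu>"
proof -
  have f': "continuous_on UNIV f" "\<mu> \<in> signed_measures"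
    "\<And>\<phi>. \<phi> \<in> schwartz_space \<Longrightarrow> integrable lborel (\<lambda>t. f t * \<phi> t)"
    "\<And>\<phi>. \<phi> \<in> schwartz_space \<Longrightarrow> (LINT t|lborel. f t * deriv (deriv \<phi>) t) = signed_integral \<mu> \<phi>"
    using f unfolding weak_second_deriv_def by auto
  show "is_continuous_function (regular_distr f) f"
    unfolding is_continuous_function_def regular_distr_def using f' by auto
  have D2: "distr_D2 (regular_distr f) = measure_distr \<mu>"
    unfolding distr_D2_def measure_distr_def regular_distr_def
    using f' schwartz_deriv_deriv by (auto simp: restrict_def fun_eq_iff)
  then show "norm_M (distr_D2 (regular_distr f)) = total_variation \<mu>" using f'(2) by (rule norm_M_D2)
  define J where "J = (LINT t|lborel. 1 / (1 + t\<^sup>2) :: real)"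
  have J: "J \<ge> 0" unfolding J_def by simp
  have C: "C \<ge> 0" using growth[of 0] by simp
  have "\<exists>C N. \<forall>\<phi>\<in>schwartz_space. \<bar>LINT t|lborel. f t * \<phi> t\<bar> \<le> C * (\<Sum>k\<le>N. \<Sum>n\<le>N. schwartz_seminorm k n \<phi>)"
  proof (intro exI ballI)
    fix \<phi> assume \<phi>: "\<phi> \<in> schwartz_space"
    have "\<bar>LINT t|lborel. f t * \<phi> t\<bar> \<le> C * (\<Sum>k\<le>3. schwartz_seminorm k 0 \<phi>) * J"
      using schwartz_integrable_linear_growth(2)[OF \<phi> borel_measurable_continuous_onI[OF f'(1)] growth, of 0]
      by (simp add: J_def)
    also have "\<dots> = (C * J) * (\<Sum>k\<le>3. \<Sum>n\<in>{0}. schwartz_seminorm k n \<phi>)" by simp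
    also have "\<dots> \<le> (C * J) * (\<Sum>k\<le>3. \<Sum>n\<le>3. schwartz_seminorm k n \<phi>)"
      using C J schwartz_seminorm_nonneg[OF \<phi>] by (intro mult_left_mono sum_mono sum_mono2) auto
    finally show "\<bar>LINT t|lborel. f t * \<phi> t\<bar> \<le> (C * J) * (\<Sum>k\<le>3. \<Sum>n\<le>3. schwartz_seminorm k n \<phi>)" .
  qed
  then have "regular_distr f \<in> tempered_distributions"
    unfolding tempered_distributions_def regular_distr_def using f'(3)
    by (auto simp: distrib_left mult.left_commute schwartz_add schwartz_cmult)
  then show "regular_distr f \<in> BV2" unfolding BV2_def bounded_measures_def using D2 f'(2) by auto
qed

lemma regular_distr_eq_imp_measure_eq:
  assumes f: "weak_second_deriv f \<mu>" and g: "weak_second_deriv g \<nu>" and eq: "regular_distr f = regular_distr g"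
  shows "\<mu> = \<nu>"
proof (rule signed_measure_eqI)
  fix \<phi> assume "\<phi> \<in> schwartz_space"
  then show "signed_integral \<mu> \<phi> = signed_integral \<nu> \<phi>"
    using f g fun_cong[OF eq, of "deriv (deriv \<phi>)"] schwartz_deriv_deriv
    by (simp add: regular_distr_def weak_second_deriv_def)
qed (use f g in \<open>simp_all add: weak_second_deriv_def\<close>)

section \<open>Balanced ramp combinations on a grid of knots\<close>

locale knots =
  fixes M :: nat and x :: "nat \<Rightarrow> real"
  assumes M2: "2 \<le> M" and mono: "strict_mono_on {1..M} x"
begin

lemma x_less: "1 \<le> i \<Longrightarrow> i < j \<Longrightarrow> j \<le> M \<Longrightarrow> x i < x j"
  using mono by (auto simp: strict_mono_on_def)

lemma x_le: "1 \<le> i \<Longrightarrow> i \<le> j \<Longrightarrow> j \<le> M \<Longrightarrow> x i \<le> x j"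
  using x_less[of i j] by (cases "i = j") auto

text \<open>
  On the left of all knots, a combination of ramps is the affine function
  \<open>(\<Sum>m. c m * x m) - (\<Sum>m. c m) * t\<close>; the two conditions make it vanish there.
\<close>

definition balanced :: "(nat \<Rightarrow> real) \<Rightarrow> bool" where
  "balanced c \<longleftrightarrow> (\<Sum>m\<in>{1..M}. c m) = 0 \<and> (\<Sum>m\<in>{1..M}. c m * x m) = 0"

definition ramps :: "(nat \<Rightarrow> real) \<Rightarrow> real \<Rightarrow> real" where
  "ramps c t = (\<Sum>m\<in>{1..M}. c m * max 0 (x m - t))"

lemma ramps_right:
  assumes "t \<ge> x M"
  shows "ramps c t = 0"
  unfolding ramps_def
proof (intro sum.neutral ballI)
  fix m assume "m \<in> {1..M}"
  then have "x m \<le> x M" by (intro x_le) auto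
  then show "c m * max 0 (x m - t) = 0" using assms by simp
qed

lemma ramps_left:
  assumes "balanced c" "t \<le> x 1"
  shows "ramps c t = 0"
proof -
  have "ramps c t = (\<Sum>m\<in>{1..M}. c m * x m - t * c m)"
    unfolding ramps_def
  proof (rule sum.cong)
    fix m assume "m \<in> {1..M}"
    then have "x 1 \<le> x m" by (intro x_le) auto
    then have "max 0 (x m - t) = x m - t" using assms(2) by simp
    then show "c m * max 0 (x m - t) = c m * x m - t * c m" by (simp add: algebra_simps)
  qed simp
  also have "\<dots> = 0" using assms(1) unfolding balanced_def by (simp add: sum_subtractf flip: sum_distrib_left)
  finally show ?thesis .
qed

text \<open>
  A triangular system: at the knot \<open>x (m - 1)\<close> only the ramps with index at least \<open>m\<close> are nonzero,
  so the coefficients vanish one after the other, from the last knot downwards. The first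
  coefficient then vanishes because all of them sum to zero.
\<close>

lemma ramps_knots_zero:
  assumes b: "balanced c" and z: "\<And>m. m \<in> {2..M-1} \<Longrightarrow> ramps c (x m) = 0"
  shows "m \<in> {1..M} \<Longrightarrow> c m = 0"
proof -
  have *: "c m = 0" if "m \<in> {2..M}" for m
    using that
  proof (induction "M - m" arbitrary: m rule: less_induct)
    case less
    have gap: "x (m - 1) < x m" using less.prems by (intro x_less) auto
    have up: "c k = 0" if "k \<in> {m<..M}" for k using less that by auto
    have "ramps c (x (m - 1)) = (\<Sum>k\<in>{m}. c k * max 0 (x k - x (m - 1)))"
      unfolding ramps_def
    proof (rule sum.mono_neutral_right)
      show "\<forall>k\<in>{1..M} - {m}. c k * max 0 (x k - x (m - 1)) = 0"
      proof
        fix k assume k: "k \<in> {1..M} - {m}"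
        show "c k * max 0 (x k - x (m - 1)) = 0"
        proof (cases "k < m")
          case True
          then have "x k \<le> x (m - 1)" using less.prems k by (intro x_le) auto
          then show ?thesis by simp
        qed (use k up in auto)
      qed
    qed (use less.prems in auto)
    also have "\<dots> = c m * (x m - x (m - 1))" using gap by simp
    finally have "c m * (x m - x (m - 1)) = ramps c (x (m - 1))" by simp
    also have "\<dots> = 0"
    proof (cases "m = 2")
      case True
      then show ?thesis using ramps_left[OF b, of "x 1"] by simp
    next
      case False
      then show ?thesis using less.prems by (intro z) auto
    qed
    finally show ?case using gap by simp
  qed
  assume m: "m \<in> {1..M}"
  show "c m = 0"
  proof (cases "m = 1")
    case True
    have "{1..M} = insert 1 {2..M}" using M2 by auto
    then have "(\<Sum>m\<in>{1..M}. c m) = c 1" using * by simp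
    then show ?thesis using b True unfolding balanced_def by simp
  qed (use m * in auto)
qed

text \<open>
  Ramp coefficients of the hat function of the interior knot \<open>x j\<close>, the piecewise linear function
  that is 1 at \<open>x j\<close> and 0 at all other knots; each one is the change of slope at its knot.
\<close>

definition hat :: "nat \<Rightarrow> nat \<Rightarrow> real" where
  "hat j m = (if m = j - 1 then 1 / (x j - x (j - 1))
     else if m = j then - 1 / (x j - x (j - 1)) - 1 / (x (j + 1) - x j)
     else if m = j + 1 then 1 / (x (j + 1) - x j) else 0)"

lemma sum_hat:
  assumes j: "j \<in> {2..M-1}"
  shows "(\<Sum>m\<in>{1..M}. hat j m * g m)
    = (g (j - 1) - g j) / (x j - x (j - 1)) + (g (j + 1) - g j) / (x (j + 1) - x j)"
proof -
  have "(\<Sum>m\<in>{1..M}. hat j m * g m) = (\<Sum>m\<in>{j - 1, j, j + 1}. hat j m * g m)"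
    using j by (intro sum.mono_neutral_right) (auto simp: hat_def)
  also have "\<dots> = hat j (j - 1) * g (j - 1) + hat j j * g j + hat j (j + 1) * g (j + 1)"
  proof -
    have "j - 1 \<notin> {j, j + 1}" using j by auto
    then show ?thesis by (simp add: add.assoc)
  qed
  also have "\<dots> = (g (j - 1) - g j) / (x j - x (j - 1)) + (g (j + 1) - g j) / (x (j + 1) - x j)"
    using j by (auto simp: hat_def algebra_simps diff_divide_distrib)
  finally show ?thesis .
qed

lemma balanced_hat: assumes j: "j \<in> {2..M-1}" shows "balanced (hat j)"
proof -
  have "x (j - 1) < x j" "x j < x (j + 1)" using j by (auto intro!: x_less)
  then show ?thesis
    using sum_hat[OF j, of "\<lambda>_. 1"] sum_hat[OF j, of x] unfolding balanced_def by (simp add: field_simps)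
qed

lemma ramps_hat:
  assumes j: "j \<in> {2..M-1}" and k: "k \<in> {1..M}"
  shows "ramps (hat j) (x k) = (if k = j then 1 else 0)"
proof -
  have d: "x (j - 1) < x j" "x j < x (j + 1)" using j by (auto intro!: x_less)
  consider "k = j" | "k \<le> j - 1" | "k \<ge> j + 1" by linarith
  then show ?thesis
  proof cases
    case 1
    then show ?thesis using d unfolding ramps_def sum_hat[OF j] by simp
  next
    case 2
    then have "x k \<le> x (j - 1)" using j k by (intro x_le) auto
    moreover have "k \<noteq> j" using 2 j by auto
    ultimately show ?thesis using d unfolding ramps_def sum_hat[OF j] by (simp add: field_simps)
  next
    case 3
    then have "x (j + 1) \<le> x k" using j k by (intro x_le) auto
    then show ?thesis using 3 d unfolding ramps_def sum_hat[OF j] by simp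
  qed
qed

text \<open>
  The hat functions form a basis that is dual to evaluation at the interior knots.
\<close>

lemma ramps_interpolate: "\<exists>c. balanced c \<and> (\<forall>m\<in>{2..M-1}. ramps c (x m) = v m)"
proof -
  define c where "c m = (\<Sum>j\<in>{2..M-1}. v j * hat j m)" for m
  have c: "(\<Sum>m\<in>{1..M}. c m * g m) = (\<Sum>j\<in>{2..M-1}. v j * (\<Sum>m\<in>{1..M}. hat j m * g m))" for g
    unfolding c_def sum_distrib_left sum_distrib_right by (subst sum.swap) (simp add: mult.assoc)
  have "balanced c"
    using c[of "\<lambda>_. 1"] c[of x] balanced_hat unfolding balanced_def by simp
  moreover have "ramps c (x m) = v m" if m: "m \<in> {2..M-1}" for m
  proof -
    have "ramps c (x m) = (\<Sum>j\<in>{2..M-1}. v j * ramps (hat j) (x m))" unfolding ramps_def c ..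
    also have "\<dots> = (\<Sum>j\<in>{2..M-1}. if j = m then v j else 0)"
      using m by (intro sum.cong) (auto simp: ramps_hat)
    also have "\<dots> = v m" using m by simp
    finally show ?thesis .
  qed
  ultimately show ?thesis by blast
qed

lemma ramps_affine:
  assumes j: "j \<in> {1..M-1}" and u: "0 \<le> u" "u \<le> 1"
  shows "ramps c ((1 - u) * x j + u * x (j + 1)) = (1 - u) * ramps c (x j) + u * ramps c (x (j + 1))"
proof -
  let ?t = "(1 - u) * x j + u * x (j + 1)"
  have d: "x j < x (j + 1)" using j by (intro x_less) auto
  have t: "?t = x j + u * (x (j + 1) - x j)" "?t = x (j + 1) - (1 - u) * (x (j + 1) - x j)"
    by (simp_all add: algebra_simps)
  have t_bounds: "x j \<le> ?t" "?t \<le> x (j + 1)"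
    using u d t(1) mult_nonneg_nonneg[of u "x (j+1) - x j"] t(2) mult_nonneg_nonneg[of "1 - u" "x (j+1) - x j"]
    by linarith+
  have "c m * max 0 (x m - ?t) = (1 - u) * (c m * max 0 (x m - x j)) + u * (c m * max 0 (x m - x (j + 1)))" if m: "m \<in> {1..M}" for m
  proof -
    have "max 0 (x m - ?t) = (1 - u) * max 0 (x m - x j) + u * max 0 (x m - x (j + 1))"
    proof (cases "m \<le> j")
      case True
      then have "x m \<le> x j" using m j by (intro x_le) auto
      then show ?thesis using t_bounds d by simp
    next
      case False
      then have "x (j + 1) \<le> x m" using m j by (intro x_le) auto
      then have "max 0 (x m - ?t) = x m - ?t" "max 0 (x m - x j) = x m - x j" "max 0 (x m - x (j + 1)) = x m - x (j + 1)"
        using t_bounds d by auto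
      then show ?thesis by (simp add: algebra_simps)
    qed
    then show ?thesis by (simp only:) (simp only: algebra_simps)
  qed
  then show ?thesis
    unfolding ramps_def sum_distrib_left sum.distrib[symmetric] by (intro sum.cong) simp_all
qed

lemma between_knots:
  assumes "x 1 \<le> t" "t \<le> x M"
  obtains j u where "j \<in> {1..M-1}" "0 \<le> u" "u \<le> 1" "t = (1 - u) * x j + u * x (j + 1)"
proof -
  have "\<exists>j\<in>{1..M-1}. x j \<le> t \<and> t \<le> x (j + 1)"
  proof (rule ccontr)
    assume n: "\<not> ?thesis"
    have "Suc k \<le> M \<longrightarrow> x (Suc k) \<le> t \<and> (0 < k \<longrightarrow> x (Suc k) < t)" for k
    proof (induction k)
      case (Suc k)
      show ?case
      proof
        assume "Suc (Suc k) \<le> M"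
        then have "Suc k \<in> {1..M-1}" "x (Suc k) \<le> t" using Suc by auto
        then have "x (Suc (Suc k)) < t" using n by (metis Suc_eq_plus1 not_le)
        then show "x (Suc (Suc k)) \<le> t \<and> (0 < Suc k \<longrightarrow> x (Suc (Suc k)) < t)" by simp
      qed
    qed (use assms in simp)
    from this[of "M - 1"] show False using M2 assms by auto
  qed
  then obtain j where j: "j \<in> {1..M-1}" "x j \<le> t" "t \<le> x (j + 1)" by blast
  then have d: "x j < x (j + 1)" by (intro x_less) auto
  define u where "u = (t - x j) / (x (j + 1) - x j)"
  have u: "u * (x (j + 1) - x j) = t - x j" using d by (simp add: u_def)
  show thesis
  proof (rule that[OF j(1)])
    show "0 \<le> u" "u \<le> 1" using j d by (simp_all add: u_def)
    show "t = (1 - u) * x j + u * x (j + 1)" using u by (simp add: algebra_simps)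
  qed
qed

end

section \<open>The canonical certificate\<close>

locale interpolation = knots +
  fixes y :: "nat \<Rightarrow> real"
begin

abbreviation a :: "nat \<Rightarrow> real" where "a \<equiv> slope_change x y"

abbreviation \<eta> :: "real \<Rightarrow> real" where "\<eta> \<equiv> eta_cano M x y"

definition alternating :: bool where
  "alternating \<longleftrightarrow> (\<forall>m\<in>{2..M-2}. a m * a (m + 1) \<le> 0)"

text \<open>
  The values of the certificate at all knots; it vanishes at the two outer ones.
\<close>

definition knot_sign :: "nat \<Rightarrow> real" where
  "knot_sign m = (if m \<in> {2..M-1} then sgn (a m) else 0)"

lemma eta_cano_ramps:
  "\<exists>c. balanced c \<and> \<eta> = ramps c \<and> (\<forall>m\<in>{1..M}. \<eta> (x m) = knot_sign m)"
proof -
  obtain c where c: "balanced c" "\<And>m. m \<in> {2..M-1} \<Longrightarrow> ramps c (x m) = sgn (a m)"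
    using ramps_interpolate[of "\<lambda>m. sgn (a m)"] by blast
  have "\<eta> = ramps c"
    unfolding eta_cano_def
  proof (rule the_equality)
    show "\<exists>c'. ramps c = (\<lambda>t. \<Sum>m\<in>{1..M}. c' m * max 0 (x m - t)) \<and> (\<Sum>m\<in>{1..M}. c' m) = 0 \<and>
       (\<Sum>m\<in>{1..M}. c' m * x m) = 0 \<and> (\<forall>m\<in>{2..M-1}. ramps c (x m) = sgn (a m))"
      using c unfolding balanced_def ramps_def by (intro exI[of _ c]) auto
  next
    fix \<eta>'
    assume "\<exists>c'. \<eta>' = (\<lambda>t. \<Sum>m\<in>{1..M}. c' m * max 0 (x m - t)) \<and> (\<Sum>m\<in>{1..M}. c' m) = 0 \<and>
       (\<Sum>m\<in>{1..M}. c' m * x m) = 0 \<and> (\<forall>m\<in>{2..M-1}. \<eta>' (x m) = sgn (a m))"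
    then obtain c' where c': "\<eta>' = ramps c'" "balanced c'" "\<And>m. m \<in> {2..M-1} \<Longrightarrow> ramps c' (x m) = sgn (a m)"
      unfolding balanced_def ramps_def[abs_def] by auto
    have "balanced (\<lambda>m. c' m - c m)"
      using c(1) c'(2) unfolding balanced_def by (simp add: sum_subtractf left_diff_distrib)
    moreover have diff: "ramps (\<lambda>m. c' m - c m) t = ramps c' t - ramps c t" for t
      unfolding ramps_def by (simp add: sum_subtractf left_diff_distrib)
    ultimately have "c' m = c m" if "m \<in> {1..M}" for m
      using ramps_knots_zero[of "\<lambda>m. c' m - c m" m] c(2) c'(3) that by simp
    then show "\<eta>' = ramps c" unfolding c'(1) ramps_def[abs_def] by simp
  qed
  moreover have "ramps c (x m) = knot_sign m" if "m \<in> {1..M}" for m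
  proof -
    have "m \<in> {2..M-1} \<or> m = 1 \<or> m = M" using that by auto
    then show ?thesis
      using c(2) ramps_left[OF c(1), of "x 1"] ramps_right[of "x M" c] M2 by (elim disjE) (auto simp: knot_sign_def)
  qed
  ultimately show ?thesis using c(1) by auto
qed

lemma eta_between_knots:
  assumes "\<eta> t \<noteq> 0"
  obtains j u where "j \<in> {1..M-1}" "0 \<le> u" "u \<le> 1" "t = (1 - u) * x j + u * x (j + 1)"
    "\<eta> t = (1 - u) * knot_sign j + u * knot_sign (j + 1)"
proof -
  obtain c where c: "balanced c" "\<eta> = ramps c" "\<And>m. m \<in> {1..M} \<Longrightarrow> \<eta> (x m) = knot_sign m"
    using eta_cano_ramps by blast
  have "x 1 \<le> t" "t \<le> x M"
    using assms ramps_left[OF c(1), of t] ramps_right[of t c] unfolding c(2) by (metis linear)+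
  then obtain j u where ju: "j \<in> {1..M-1}" "0 \<le> u" "u \<le> 1" "t = (1 - u) * x j + u * x (j + 1)"
    by (rule between_knots)
  moreover have "\<eta> t = (1 - u) * knot_sign j + u * knot_sign (j + 1)"
    unfolding ju(4) c(2) ramps_affine[OF ju(1-3)] using c(3)[of j] c(3)[of "j + 1"] ju(1) unfolding c(2) by auto
  ultimately show ?thesis by (rule that)
qed

lemma knot_sign_values: "knot_sign m = 0 \<or> knot_sign m = 1 \<or> knot_sign m = -1"
  by (simp add: knot_sign_def sgn_real_def)

lemma eta_bounded: "\<bar>\<eta> t\<bar> \<le> 1"
proof (cases "\<eta> t = 0")
  case False
  then obtain j u where "0 \<le> u" "u \<le> 1" "\<eta> t = (1 - u) * knot_sign j + u * knot_sign (j + 1)"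
    by (rule eta_between_knots)
  then show ?thesis using knot_sign_values[of j] knot_sign_values[of "j + 1"] by (auto simp: abs_le_iff)
qed simp

lemma eta_measurable: "\<eta> \<in> borel_measurable borel"
proof -
  obtain c where "\<eta> = ramps c" using eta_cano_ramps by metis
  then show ?thesis using measurable_hats[of c x "{1..M}"] unfolding ramps_def[abs_def] by simp
qed

text \<open>
  A strict convex combination of two values in \<open>{-1, 0, 1}\<close> that are not equal and nonzero has
  absolute value less than one, so saturation occurs at the end of a segment only.
\<close>

lemma saturation_knots:
  assumes alt: "alternating" and t: "\<bar>\<eta> t\<bar> = 1"
  shows "t \<in> x ` {2..M-1}"
proof -
  have "\<eta> t \<noteq> 0" using t by auto
  then obtain j u where ju: "j \<in> {1..M-1}" "0 \<le> u" "u \<le> 1" "t = (1 - u) * x j + u * x (j + 1)"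
    "\<eta> t = (1 - u) * knot_sign j + u * knot_sign (j + 1)"
    by (rule eta_between_knots)
  have opp: "knot_sign j * knot_sign (j + 1) \<le> 0"
  proof (cases "j \<in> {2..M-2}")
    case True
    then have "a j * a (j + 1) \<le> 0" using alt unfolding alternating_def by blast
    then show ?thesis by (auto simp: knot_sign_def sgn_real_def mult_le_0_iff split: if_splits)
  next
    case False
    then have "j \<notin> {2..M-1} \<or> j + 1 \<notin> {2..M-1}" using ju(1) by auto
    then show ?thesis by (auto simp: knot_sign_def)
  qed
  have "u = 0 \<or> u = 1"
  proof (rule ccontr)
    assume "\<not> ?thesis"
    then have "0 < u" "u < 1" using ju by auto
    then show False using t opp ju(5) knot_sign_values[of j] knot_sign_values[of "j + 1"]
      by (auto simp: abs_if split: if_splits)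
  qed
  then have "(t = x j \<and> \<eta> t = knot_sign j) \<or> (t = x (j + 1) \<and> \<eta> t = knot_sign (j + 1))"
    using ju(4,5) by auto
  then obtain m where "t = x m" "knot_sign m = \<eta> t" by metis
  then show ?thesis using \<open>\<eta> t \<noteq> 0\<close> by (auto simp: knot_sign_def split: if_splits)
qed

lemma same_signs:
  assumes "\<not> alternating"
  obtains m where "m \<in> {2..M-2}" "a m * a (m + 1) > 0"
  using assms unfolding alternating_def by (auto simp: not_le)

lemma nondegenerate_iff: "nondegenerate \<eta> \<longleftrightarrow> alternating"
proof
  assume alt: "alternating"
  have "signed_saturation_set \<eta> \<subseteq> x ` {2..M-1} \<times> {1, -1}"
    unfolding signed_saturation_set_def using saturation_knots[OF alt] by auto
  then have "finite (signed_saturation_set \<eta>)" by (rule finite_subset) simp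
  then show "nondegenerate \<eta>"
    unfolding nondegenerate_def by (auto intro!: discreteI simp: isolated_in_islimpt_iff islimpt_finite)
next
  assume nd: "nondegenerate \<eta>"
  show "alternating"
  proof (rule ccontr)
    assume "\<not> alternating"
    then obtain m where m: "m \<in> {2..M-2}" "a m * a (m + 1) > 0" by (rule same_signs)
    obtain c where c: "balanced c" "\<eta> = ramps c" "\<And>m. m \<in> {1..M} \<Longrightarrow> \<eta> (x m) = knot_sign m"
      using eta_cano_ramps by blast
    define \<sigma> where "\<sigma> = sgn (a m)"
    have \<sigma>: "\<sigma> = 1 \<or> \<sigma> = -1" "sgn (a (m + 1)) = \<sigma>"
      using m(2) by (auto simp: \<sigma>_def sgn_real_def zero_less_mult_iff)
    have mm: "m \<in> {1..M}" "m + 1 \<in> {1..M}" "m \<in> {1..M-1}" "m \<in> {2..M-1}" "m + 1 \<in> {2..M-1}" using m(1) by auto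
    have ends: "ramps c (x m) = \<sigma>" "ramps c (x (m + 1)) = \<sigma>"
      using c(3)[OF mm(1)] c(3)[OF mm(2)] mm(4,5) \<sigma>(2) unfolding c(2) knot_sign_def \<sigma>_def by simp_all
    have seg: "\<eta> ((1 - u) * x m + u * x (m + 1)) = \<sigma>" if "0 \<le> u" "u \<le> 1" for u
      unfolding c(2) ramps_affine[OF mm(3) that] ends by (simp add: algebra_simps)
    have sat: "(t, \<sigma>) \<in> signed_saturation_set \<eta>" if "\<eta> t = \<sigma>" for t
      using that \<sigma>(1) by (auto simp: signed_saturation_set_def)
    have "(x m, \<sigma>) \<in> signed_saturation_set \<eta>" using sat seg[of 0] by simp
    then have "(x m, \<sigma>) isolated_in signed_saturation_set \<eta>"
      using nd unfolding nondegenerate_def by (rule discreteD[rotated])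
    then obtain e where e: "e > 0" "\<And>z. z \<in> signed_saturation_set \<eta> \<Longrightarrow> dist (x m, \<sigma>) z < e \<Longrightarrow> z = (x m, \<sigma>)"
      unfolding isolated_in_dist_Ex_iff by blast
    define d where "d = x (m + 1) - x m"
    have d: "d > 0" unfolding d_def using mm by (simp add: x_less)
    define u where "u = min 1 (e / (2 * d))"
    have u: "0 < u" "u \<le> 1" "u * d < e"
      using e(1) d by (auto simp: u_def min_def field_simps)
    let ?t = "(1 - u) * x m + u * x (m + 1)"
    have t: "?t = x m + u * d" by (simp add: d_def algebra_simps)
    have "(?t, \<sigma>) \<in> signed_saturation_set \<eta>" using sat seg u by simp
    moreover have "dist (x m, \<sigma>) (?t, \<sigma>) < e"
      unfolding t using u d by (simp add: dist_Pair_Pair dist_real_def)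
    ultimately have "?t = x m" using e(2) by blast
    then show False using t u d by simp
  qed
qed

section \<open>Optimal value and uniqueness\<close>

text \<open>
  The first segment prolonged to the whole line, plus one kink per interior knot.
\<close>

abbreviation interpolant :: "real \<Rightarrow> real" where
  "interpolant \<equiv> spline (y 1 - (y 2 - y 1) / (x 2 - x 1) * x 1) ((y 2 - y 1) / (x 2 - x 1)) {2..M-1} a x"

lemma slope_telescope:
  "j \<ge> 1 \<Longrightarrow> (y 2 - y 1) / (x 2 - x 1) + (\<Sum>i\<in>{2..j}. a i) = (y (j + 1) - y j) / (x (j + 1) - x j)"
proof (induction j rule: nat_induct_at_least)
  case (Suc j)
  then have "{2..Suc j} = insert (Suc j) {2..j}" by auto
  with Suc show ?case by (simp add: slope_change_def)
qed (simp add: numeral_2_eq_2)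

lemma interpolant_knots: "j \<ge> 1 \<Longrightarrow> j \<le> M \<Longrightarrow> interpolant (x j) = y j"
proof (induction j rule: nat_induct_at_least)
  case base
  have "(\<Sum>i\<in>{2..M-1}. a i * max 0 (x 1 - x i)) = 0"
    using x_le[of 1] by (intro sum.neutral) auto
  then show ?case by (simp add: spline_def algebra_simps)
next
  case (Suc j)
  have d: "x j < x (j + 1)" using Suc by (intro x_less) auto
  have "(\<Sum>i\<in>{2..M-1}. a i * max 0 (x (j + 1) - x i)) - (\<Sum>i\<in>{2..M-1}. a i * max 0 (x j - x i))
    = (\<Sum>i\<in>{2..M-1}. a i * (max 0 (x (j + 1) - x i) - max 0 (x j - x i)))"
    by (simp add: sum_subtractf right_diff_distrib)
  also have "\<dots> = (\<Sum>i\<in>{2..M-1}. if i \<in> {2..j} then a i * (x (j + 1) - x j) else 0)"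
  proof (rule sum.cong)
    fix i assume i: "i \<in> {2..M-1}"
    show "a i * (max 0 (x (j + 1) - x i) - max 0 (x j - x i)) = (if i \<in> {2..j} then a i * (x (j + 1) - x j) else 0)"
    proof (cases "i \<le> j")
      case True
      then have "x i \<le> x j" using i Suc by (intro x_le) auto
      then show ?thesis using True i d by simp
    next
      case False
      then have "x (j + 1) \<le> x i" using i by (intro x_le) auto
      then show ?thesis using False d by simp
    qed
  qed simp
  also have "\<dots> = (\<Sum>i\<in>{2..j}. a i * (x (j + 1) - x j))"
    using Suc by (subst sum.inter_restrict[symmetric]) (auto intro!: sum.cong)
  finally have step: "(\<Sum>i\<in>{2..M-1}. a i * max 0 (x (j + 1) - x i)) - (\<Sum>i\<in>{2..M-1}. a i * max 0 (x j - x i))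
    = (\<Sum>i\<in>{2..j}. a i) * (x (j + 1) - x j)" by (simp add: sum_distrib_right)
  have "interpolant (x (j + 1)) - interpolant (x j) = (y 2 - y 1) / (x 2 - x 1) * (x (j + 1) - x j)
    + ((\<Sum>i\<in>{2..M-1}. a i * max 0 (x (j + 1) - x i)) - (\<Sum>i\<in>{2..M-1}. a i * max 0 (x j - x i)))"
    by (simp add: spline_def right_diff_distrib)
  also have "\<dots> = ((y 2 - y 1) / (x 2 - x 1) + (\<Sum>i\<in>{2..j}. a i)) * (x (j + 1) - x j)"
    unfolding step by (simp only: distrib_right)
  also have "\<dots> = y (j + 1) - y j"
    unfolding slope_telescope[OF Suc(1)] using d by simp
  finally show ?case using Suc by simp
qed

definition optimum :: real where "optimum = (\<Sum>m\<in>{2..M-1}. \<bar>a m\<bar>)"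

lemma interpolant_weak_second_deriv: "weak_second_deriv interpolant (dirac_sum {2..M-1} a x)"
  by (rule weak_second_deriv_spline) simp

text \<open>
  The pairing depends on \<open>f\<close> only through its values at the knots, so it may be computed for the
  interpolant, whose second derivative is a sum of point masses.
\<close>

lemma certificate_pairing:
  assumes f: "weak_second_deriv f \<mu>" and fy: "\<And>m. m \<in> {1..M} \<Longrightarrow> f (x m) = y m"
  shows "signed_integral \<mu> \<eta> = optimum"
proof -
  obtain c where c: "balanced c" "\<eta> = ramps c" "\<And>m. m \<in> {1..M} \<Longrightarrow> \<eta> (x m) = knot_sign m"
    using eta_cano_ramps by blast
  have pair: "signed_integral \<nu> \<eta> = (\<Sum>m\<in>{1..M}. c m * y m)"
    if g: "weak_second_deriv g \<nu>" and gy: "\<And>m. m \<in> {1..M} \<Longrightarrow> g (x m) = y m" for g \<nu>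
    using weak_second_deriv_hats[OF g, of "{1..M}" c x] c(1) gy
    unfolding c(2) ramps_def[abs_def] balanced_def by simp
  have "signed_integral \<mu> \<eta> = signed_integral (dirac_sum {2..M-1} a x) \<eta>"
    using pair[OF f fy] pair[OF interpolant_weak_second_deriv] interpolant_knots by simp
  also have "\<dots> = (\<Sum>m\<in>{2..M-1}. a m * \<eta> (x m))"
    by (rule signed_integral_dirac_sum[OF _ eta_measurable]) simp
  also have "\<dots> = optimum"
    unfolding optimum_def using c(3) by (intro sum.cong) (auto simp: knot_sign_def abs_sgn)
  finally show ?thesis .
qed

lemma optimum_le:
  assumes T: "T \<in> gBPC_feasible M x y"
  shows "ennreal optimum \<le> norm_M (distr_D2 T)"
proof -
  obtain f where f: "T \<in> BV2" "is_continuous_function T f" "\<And>m. m \<in> {1..M} \<Longrightarrow> f (x m) = y m"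
    using T unfolding gBPC_feasible_def by auto
  obtain \<mu> where \<mu>: "weak_second_deriv f \<mu>" "norm_M (distr_D2 T) = total_variation \<mu>"
    using BV2_E[OF f(1,2)] by metis
  have "\<mu> \<in> signed_measures" using \<mu>(1) unfolding weak_second_deriv_def by simp
  from signed_integral_le_variation[OF this eta_measurable eta_bounded]
  show ?thesis using certificate_pairing[OF \<mu>(1) f(3)] \<mu>(2) by simp
qed

lemma spline_feasible:
  assumes I: "finite I" and y: "\<And>m. m \<in> {1..M} \<Longrightarrow> spline \<alpha> \<beta> I b s (x m) = y m"
  shows "regular_distr (spline \<alpha> \<beta> I b s) \<in> gBPC_feasible M x y"
    and "norm_M (distr_D2 (regular_distr (spline \<alpha> \<beta> I b s))) \<le> ennreal (\<Sum>i\<in>I. \<bar>b i\<bar>)"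
proof -
  obtain C where C: "\<And>t. \<bar>spline \<alpha> \<beta> I b s t\<bar> \<le> C * (1 + \<bar>t\<bar>)" using spline_linear_growth by blast
  note R = regular_distr_BV2[OF weak_second_deriv_spline[OF I] C]
  show "regular_distr (spline \<alpha> \<beta> I b s) \<in> gBPC_feasible M x y"
    unfolding gBPC_feasible_def using R(1,2) y by blast
  show "norm_M (distr_D2 (regular_distr (spline \<alpha> \<beta> I b s))) \<le> ennreal (\<Sum>i\<in>I. \<bar>b i\<bar>)"
    unfolding R(3) by (rule total_variation_dirac_sum)
qed

text \<open>
  The certificate bounds all feasible costs from below by \<^const>\<open>optimum\<close>, and the interpolant
  attains this bound.
\<close>

lemma solution_iff:
  "gBPC_solution M x y T \<longleftrightarrow> T \<in> gBPC_feasible M x y \<and> norm_M (distr_D2 T) \<le> ennreal optimum"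
proof -
  have "regular_distr interpolant \<in> gBPC_feasible M x y" "norm_M (distr_D2 (regular_distr interpolant)) \<le> ennreal optimum"
    unfolding optimum_def using interpolant_knots by (intro spline_feasible; simp)+
  then show ?thesis
    unfolding gBPC_solution_def is_arg_min_def using optimum_le by (meson leD leI order_trans)
qed

lemma interpolant_solution: "gBPC_solution M x y (regular_distr interpolant)"
  unfolding solution_iff optimum_def using interpolant_knots by (intro conjI spline_feasible) simp_all

text \<open>
  An optimal measure lives on the saturation set of the certificate, hence on the interior knots.
  Its mass at a knot is its pairing with the hat function of that knot, which only depends on the
  data.
\<close>

lemma unique_solution:
  assumes alt: "alternating" and T: "gBPC_solution M x y T"
  shows "T = regular_distr interpolant"
proof -
  let ?\<mu>0 = "dirac_sum {2..M-1} a x" and ?S = "x ` {2..M-1}"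
  obtain f where f: "T \<in> BV2" "is_continuous_function T f" "\<And>m. m \<in> {1..M} \<Longrightarrow> f (x m) = y m"
    using T unfolding solution_iff gBPC_feasible_def by auto
  obtain \<mu> where \<mu>: "weak_second_deriv f \<mu>" "norm_M (distr_D2 T) = total_variation \<mu>" "T = regular_distr f"
    using BV2_E[OF f(1,2)] .
  have sm: "\<mu> \<in> signed_measures" using \<mu>(1) unfolding weak_second_deriv_def by simp
  have "total_variation \<mu> \<le> ennreal (signed_integral \<mu> \<eta>)"
    using T certificate_pairing[OF \<mu>(1) f(3)] \<mu>(2) unfolding solution_iff by simp
  then have supp: "supported_on \<mu> ?S"
    unfolding supported_on_def using saturation_knots[OF alt]
    by (blast intro: extremal_measure_null[OF sm eta_measurable eta_bounded])
  have supp0: "supported_on ?\<mu>0 ?S"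
    unfolding supported_on_def dirac_sum_def by (auto intro!: sum.neutral simp: indicator_def)
  have inj: "inj_on x {2..M-1}"
    using strict_mono_on_imp_inj_on[OF mono] by (rule inj_on_subset) auto
  have atom: "\<nu> {x j} = (\<Sum>m\<in>{1..M}. hat j m * y m)"
    if g: "weak_second_deriv g \<nu>" "\<And>m. m \<in> {1..M} \<Longrightarrow> g (x m) = y m" and "supported_on \<nu> ?S"
      and j: "j \<in> {2..M-1}" for g \<nu> j
  proof -
    have \<nu>: "\<nu> \<in> signed_measures" using g(1) unfolding weak_second_deriv_def by simp
    have "(\<Sum>m\<in>{1..M}. hat j m * y m) = signed_integral \<nu> (ramps (hat j))"
      using weak_second_deriv_hats[OF g(1), of "{1..M}" "hat j" x] balanced_hat[OF j] g(2)
      unfolding ramps_def[abs_def] balanced_def by simp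
    also have "\<dots> = (\<Sum>s\<in>?S. ramps (hat j) s * \<nu> {s})"
      using measurable_hats[of "hat j" x "{1..M}"] \<open>supported_on \<nu> ?S\<close>
      unfolding ramps_def[abs_def] by (intro signed_integral_finite_support[OF \<nu>]) auto
    also have "\<dots> = (\<Sum>m\<in>{2..M-1}. ramps (hat j) (x m) * \<nu> {x m})"
      using inj by (simp add: sum.reindex)
    also have "\<dots> = (\<Sum>m\<in>{2..M-1}. if m = j then \<nu> {x m} else 0)"
      using j by (intro sum.cong) (auto simp: ramps_hat)
    also have "\<dots> = \<nu> {x j}" using j by simp
    finally show ?thesis by simp
  qed
  have atoms: "\<mu> {x j} = ?\<mu>0 {x j}" if "j \<in> {2..M-1}" for j
    using atom[OF \<mu>(1) f(3) supp that] atom[OF interpolant_weak_second_deriv _ supp0 that] interpolant_knots by simp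
  have "(\<Sum>s\<in>?S. \<phi> s * \<mu> {s}) = (\<Sum>s\<in>?S. \<phi> s * ?\<mu>0 {s})" for \<phi> :: "real \<Rightarrow> real"
    by (intro sum.cong) (auto simp: atoms)
  then have "signed_integral \<mu> \<phi> = signed_integral ?\<mu>0 \<phi>" if "\<phi> \<in> schwartz_space" for \<phi>
    using signed_integral_finite_support[OF sm _ supp schwartz_continuous(3)[OF that]]
      signed_integral_finite_support[OF dirac_sum_signed_measures _ supp0 schwartz_continuous(3)[OF that]]
    by simp
  then have "\<mu> = ?\<mu>0" by (rule signed_measure_eqI[OF sm dirac_sum_signed_measures])
  then have "f = interpolant"
    using weak_second_deriv_unique[OF \<mu>(1)[unfolded \<open>\<mu> = ?\<mu>0\<close>] interpolant_weak_second_deriv, of "x 1" "x 2"]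
      x_less[of 1 2] M2 f(3)[of 1] f(3)[of 2] interpolant_knots[of 1] interpolant_knots[of 2] by simp
  then show ?thesis using \<mu>(3) by simp
qed

text \<open>
  Two neighbouring kinks of the same sign are replaced by one kink of their total mass at their
  barycentre. The function changes only strictly between the two knots, and since the signs agree
  the total variation stays the same.
\<close>

lemma second_solution:
  assumes "\<not> alternating"
  shows "\<exists>T. gBPC_solution M x y T \<and> T \<noteq> regular_distr interpolant"
proof -
  obtain k where k: "k \<in> {2..M-2}" "a k * a (k + 1) > 0" using assms by (rule same_signs)
  \<comment> \<open>total mass and barycentre of the two kinks\<close>
  define w where "w = a k + a (k + 1)"
  define s where "s = (a k * x k + a (k + 1) * x (k + 1)) / w"
  have w: "w \<noteq> 0" "\<bar>w\<bar> = \<bar>a k\<bar> + \<bar>a (k + 1)\<bar>" "a k / w > 0" "a (k + 1) / w > 0"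
    using k(2) unfolding w_def by (auto simp: zero_less_mult_iff divide_simps)
  have ws: "w * s = a k * x k + a (k + 1) * x (k + 1)" using w(1) by (simp add: s_def)
  have d: "x k < x (k + 1)" using k by (intro x_less) auto
  have "s - x k = a (k + 1) / w * (x (k + 1) - x k)" "x (k + 1) - s = a k / w * (x (k + 1) - x k)"
    using w(1) unfolding s_def by (simp_all add: field_simps) (simp_all add: w_def algebra_simps)
  moreover have "0 < a (k + 1) / w * (x (k + 1) - x k)" "0 < a k / w * (x (k + 1) - x k)"
    using w d by (intro mult_pos_pos; simp)+
  ultimately have "s - x k > 0" "x (k + 1) - s > 0" by simp_all
  then have s: "x k < s" "s < x (k + 1)" by simp_all
  let ?\<alpha> = "y 1 - (y 2 - y 1) / (x 2 - x 1) * x 1" and ?\<beta> = "(y 2 - y 1) / (x 2 - x 1)"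
  \<comment> \<open>the merged kink takes the index \<open>k\<close>; index \<open>k + 1\<close> stays, with mass zero\<close>
  define b where "b = a(k := w, k + 1 := 0)"
  define z where "z = x(k := s)"
  let ?g = "spline ?\<alpha> ?\<beta> {2..M-1} b z"
  have split: "(\<Sum>i\<in>{2..M-1}. h i) = h k + h (k + 1) + (\<Sum>i\<in>{2..M-1} - {k, k + 1}. h i)" for h :: "nat \<Rightarrow> real"
  proof -
    have "(\<Sum>i\<in>{2..M-1}. h i) = (\<Sum>i\<in>{k, k + 1}. h i) + (\<Sum>i\<in>{2..M-1} - {k, k + 1}. h i)"
      using k(1) by (subst sum.subset_diff[of "{k, k + 1}"]) auto
    then show ?thesis by simp
  qed
  have rest: "(\<Sum>i\<in>{2..M-1} - {k, k + 1}. b i * max 0 (t - z i)) = (\<Sum>i\<in>{2..M-1} - {k, k + 1}. a i * max 0 (t - x i))" for t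
    by (intro sum.cong) (auto simp: b_def z_def)
  have g: "?g t = interpolant t + (w * max 0 (t - s) - a k * max 0 (t - x k) - a (k + 1) * max 0 (t - x (k + 1)))" for t
    unfolding spline_def split[of "\<lambda>i. b i * max 0 (t - z i)"] split[of "\<lambda>i. a i * max 0 (t - x i)"] rest
    by (simp add: b_def z_def)
  have gy: "?g (x m) = y m" if m: "m \<in> {1..M}" for m
  proof (cases "m \<le> k")
    case True
    then have "x m \<le> x k" using m k by (intro x_le) auto
    then show ?thesis using g[of "x m"] s m interpolant_knots[of m] by simp
  next
    case False
    then have "x (k + 1) \<le> x m" using m k by (intro x_le) auto
    then have "w * max 0 (x m - s) - a k * max 0 (x m - x k) - a (k + 1) * max 0 (x m - x (k + 1))
      = w * (x m - s) - a k * (x m - x k) - a (k + 1) * (x m - x (k + 1))" using s by simp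
    also have "\<dots> = 0" using ws by (simp add: w_def algebra_simps)
    finally show ?thesis using g[of "x m"] m interpolant_knots[of m] by simp
  qed
  have "(\<Sum>i\<in>{2..M-1} - {k, k + 1}. \<bar>b i\<bar>) = (\<Sum>i\<in>{2..M-1} - {k, k + 1}. \<bar>a i\<bar>)"
    by (intro sum.cong) (auto simp: b_def)
  then have norm: "(\<Sum>i\<in>{2..M-1}. \<bar>b i\<bar>) = optimum"
    unfolding optimum_def split[of "\<lambda>i. \<bar>b i\<bar>"] split[of "\<lambda>i. \<bar>a i\<bar>"] using w(2) by (simp add: b_def)
  have "gBPC_solution M x y (regular_distr ?g)"
    unfolding solution_iff norm[symmetric] using gy by (intro conjI spline_feasible) auto
  moreover have "regular_distr ?g \<noteq> regular_distr interpolant"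
  proof
    assume eq: "regular_distr ?g = regular_distr interpolant"
    have wg: "weak_second_deriv ?g (dirac_sum {2..M-1} b z)" by (rule weak_second_deriv_spline) simp
    have "dirac_sum {2..M-1} b z = dirac_sum {2..M-1} a x"
      by (rule regular_distr_eq_imp_measure_eq[OF wg interpolant_weak_second_deriv eq])
    then have "?g = interpolant"
      using weak_second_deriv_unique[OF wg _ , of interpolant "x 1" "x 2"] interpolant_weak_second_deriv
        x_less[of 1 2] M2 gy[of 1] gy[of 2] interpolant_knots[of 1] interpolant_knots[of 2] by simp
    then have "a k * (s - x k) = 0" using g[of s] s by simp
    then show False using s k(2) by auto
  qed
  ultimately show ?thesis by blast
qed

lemma unique_solution_iff: "(\<exists>!T. gBPC_solution M x y T) \<longleftrightarrow> alternating"
  using interpolant_solution unique_solution second_solution by metis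

end

theorem proposition6:
  fixes M :: nat and x y\<^sub>0 :: "nat \<Rightarrow> real"
  assumes "M \<ge> 2"
    and "strict_mono_on {1..M} x"
  shows "((\<exists>!T. gBPC_solution M x y\<^sub>0 T) \<longleftrightarrow> nondegenerate (eta_cano M x y\<^sub>0)) \<and>
         (nondegenerate (eta_cano M x y\<^sub>0) \<longleftrightarrow>
            (\<forall>m\<in>{2..M-2}. slope_change x y\<^sub>0 m * slope_change x y\<^sub>0 (m + 1) \<le> 0))"
proof -
  interpret interpolation M x y\<^sub>0
    using assms by unfold_locales
  show ?thesis
    using unique_solution_iff nondegenerate_iff unfolding alternating_def by simp
qed

end
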